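(* Let $\kappa$ be an infinite regular cardinal. Then for every ordinal $\xi$ with $2^{|\xi|}<\kappa$, every natural number $k$, and every non-$(2^{<\kappa})$-special tree $T$, we have \[ T \to (\kappa+\xi)^2_k, \] i.e. for every colouring $c:[T]^2\to k$ there is a chain $X\subseteq T$ of order type $\kappa+\xi$ and a colour $\chi<k$ with $c(\{s,t\})=\chi$ for all distinct $s,t\in X$.
   Context: A tree is a partially ordered set $(T,<_T)$ in which the set of predecessors of every node is well-ordered by $<_T$. For an infinite cardinal $\mu$, a tree $T$ is $\mu$-special if it can be written as a union of at most $\mu$ antichains; otherwise it is non-$\mu$-special. For cardinals $\nu\ge 2$ and infinite $\kappa$, $\nu^{<\kappa}=\sup_{\mu<\kappa}\nu^\mu$ (supremum over cardinals $\mu<\kappa$, cardinal exponentiation). $[T]^2$ is the set of two-element chains of $T$. *)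

theory Defs
  imports Main "HOL-Library.Ramsey" "HOL-Library.FuncSet"
begin

unbundle cardinal_syntax

text \<open>
  Orders are the reflexive relations of \<^theory>\<open>HOL.Order_Relation\<close>, so a strict order
  \<open><\<^sub>T\<close> is \<open>r - Id\<close>. Ordinals are well-orders \<open>r\<close> (\<^prop>\<open>Well_order r\<close>), compared by
  \<open>=o\<close>, \<open>\<le>o\<close>, \<open><o\<close>; cardinals are the \<open>\<le>o\<close>-minimal well-orders on their field
  (\<^prop>\<open>Card_order r\<close>), i.e. initial ordinals.
\<close>

subsection \<open>Suprema of cardinals and weak powers\<close>

definition is_card_Sup :: "'a rel set \<Rightarrow> 'a rel \<Rightarrow> bool" where
  "is_card_Sup R s \<longleftrightarrow>
     Card_order s \<and> (\<forall>r\<in>R. r \<le>o s) \<and>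
     (\<forall>s' :: 'a rel. Card_order s' \<and> (\<forall>r\<in>R. r \<le>o s') \<longrightarrow> s \<le>o s')"

definition card_Sup :: "'a rel set \<Rightarrow> 'a rel" where
  "card_Sup R = (SOME s. is_card_Sup R s)"

lemma is_card_Sup_card_Sup:
  fixes R :: "'a rel set"
  assumes "\<And>r. r \<in> R \<Longrightarrow> Card_order r"
  shows "is_card_Sup R (card_Sup R)"
proof -
  let ?U = "{s :: 'a rel. Card_order s \<and> (\<forall>r\<in>R. r \<le>o s)}"
  have "r \<le>o |UNIV :: 'a set|" if "r \<in> R" for r
  proof -
    have "|Field r| =o r"
      using assms[OF that] by (rule card_of_Field_ordIso)
    moreover have "|Field r| \<le>o |UNIV :: 'a set|"
      by (rule card_of_mono1) simp
    ultimately show ?thesis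
      by (metis ordIso_ordLeq_trans ordIso_symmetric)
  qed
  then have "|UNIV :: 'a set| \<in> ?U"
    by (simp add: card_of_Card_order)
  then have "\<exists>s\<in>?U. \<forall>s'\<in>?U. s \<le>o s'"
    by (intro exists_minim_Card_order) auto
  then obtain s where s: "s \<in> ?U" "\<forall>s'\<in>?U. s \<le>o s'" ..
  then have "is_card_Sup R s"
    unfolding is_card_Sup_def by simp
  then show ?thesis
    unfolding card_Sup_def by (rule someI)
qed

text \<open>
  The bounds compared in \<^const>\<open>is_card_Sup\<close> live on one type; the supremum is
  nevertheless below upper bounds on any other type.
\<close>

lemma card_Sup_least:
  fixes R :: "'a rel set" and s' :: "'b rel"
  assumes R: "\<And>r. r \<in> R \<Longrightarrow> Card_order r"
    and s': "Card_order s'" and ub: "\<And>r. r \<in> R \<Longrightarrow> r \<le>o s'"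
  shows "card_Sup R \<le>o s'"
proof (rule ccontr)
  have S: "is_card_Sup R (card_Sup R)"
    using R by (rule is_card_Sup_card_Sup)
  then have co: "Card_order (card_Sup R)"
    unfolding is_card_Sup_def by simp
  assume "\<not> card_Sup R \<le>o s'"
  then have "s' <o card_Sup R"
    using not_ordLeq_iff_ordLess[OF card_order_on_well_order_on[OF s']
        card_order_on_well_order_on[OF co]] by simp
  then have "|Field s'| <o card_Sup R"
    by (rule ordIso_ordLess_trans[OF card_of_Field_ordIso[OF s']])
  then obtain B :: "'a set" where B: "|Field s'| =o |B|" "|B| <o card_Sup R"
    using internalize_card_of_ordLess[of "Field s'" "card_Sup R"] by auto
  have "s' =o |B|"
    by (rule ordIso_transitive[OF ordIso_symmetric[OF card_of_Field_ordIso[OF s']] B(1)])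
  then have "\<forall>r\<in>R. r \<le>o |B|"
    by (intro ballI ordLeq_ordIso_trans[OF ub])
  then have "card_Sup R \<le>o |B|"
    using S card_of_Card_order[of B] unfolding is_card_Sup_def by simp
  then show False
    using B(2) not_ordLess_ordLeq[of "|B|" "card_Sup R"] by simp
qed

text \<open>
  The weak power \<open>\<nu>\<^sup><\<^sup>\<kappa>\<close>. Every cardinal below \<open>\<kappa>\<close> is represented on the type of \<open>\<kappa>\<close>.
\<close>

definition weak_cexp :: "'n rel \<Rightarrow> 'k rel \<Rightarrow> ('k \<Rightarrow> 'n) rel" where
  "weak_cexp \<nu> \<kappa> = card_Sup {\<nu> ^c \<mu> | \<mu> :: 'k rel. Card_order \<mu> \<and> \<mu> <o \<kappa>}"

subsection \<open>Ordinal sum\<close>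

definition ord_sum :: "'a rel \<Rightarrow> 'b rel \<Rightarrow> ('a + 'b) rel" where
  "ord_sum r s =
     {(Inl a, Inl a') | a a'. (a, a') \<in> r} \<union>
     {(Inr b, Inr b') | b b'. (b, b') \<in> s} \<union>
     {(Inl a, Inr b) | a b. a \<in> Field r \<and> b \<in> Field s}"

subsection \<open>Trees\<close>

definition tree_on :: "'a set \<Rightarrow> 'a rel \<Rightarrow> bool" where
  "tree_on T r \<longleftrightarrow>
     partial_order_on T r \<and>
     (\<forall>t\<in>T. well_order_on (underS r t) (Restr r (underS r t)))"

definition antichain_in :: "'a set \<Rightarrow> 'a rel \<Rightarrow> 'a set \<Rightarrow> bool" where
  "antichain_in T r A \<longleftrightarrow>
     A \<subseteq> T \<and> (\<forall>s\<in>A. \<forall>t\<in>A. s \<noteq> t \<longrightarrow> (s, t) \<notin> r \<and> (t, s) \<notin> r)"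

definition special_tree :: "'m rel \<Rightarrow> 'a set \<Rightarrow> 'a rel \<Rightarrow> bool" where
  "special_tree \<mu> T r \<longleftrightarrow>
     (\<exists>\<A>. |\<A>| \<le>o \<mu> \<and> (\<forall>A\<in>\<A>. antichain_in T r A) \<and> \<Union>\<A> = T)"

definition chain_pairs :: "'a set \<Rightarrow> 'a rel \<Rightarrow> 'a set set" where
  "chain_pairs T r = [T]\<^bsup>2\<^esup> \<inter> Chains r"

text \<open>
  The partition relation \<open>T \<rightarrow> (\<alpha>)\<^sup>2\<^sub>k\<close>, for an ordinal \<open>\<alpha>\<close>; the set of colours is
  \<^term>\<open>{..<k}\<close>.
\<close>

definition tree_arrow :: "'a set \<Rightarrow> 'a rel \<Rightarrow> 'o rel \<Rightarrow> nat \<Rightarrow> bool" where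
  "tree_arrow T r \<alpha> k \<longleftrightarrow>
     (\<forall>c \<in> chain_pairs T r \<rightarrow> {..<k}.
        \<exists>X \<chi>. X \<subseteq> T \<and> X \<in> Chains r \<and> Restr r X =o \<alpha> \<and> \<chi> < k \<and>
              (\<forall>s\<in>X. \<forall>t\<in>X. s \<noteq> t \<longrightarrow> c {s, t} = \<chi>))"

end

theory Submission
  imports Defs
begin

text \<open>
  For a node \<open>t\<close>, sets of fewer than \<open>\<kappa>\<close> predecessors of \<open>t\<close> play the role of the parameters in an
  elementary submodel attached to \<open>t\<close>. A nonspecial tree is stationary for a normal ideal
  defined by pressing down to such sets. A set \<open>X\<close> below \<open>t\<close> reflects \<open>t\<close> if it meets every set of
  nodes that have the same colours as \<open>t\<close> over such a set of parameters; a stationary set reflects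
  almost all of its elements.

  Iterating along a list \<open>\<sigma>\<close> of colours yields \<open>\<kappa>\<close>-complete ideals such that every positive set
  contains, for each colour in \<open>\<sigma>\<close>, a homogeneous set of type \<open>\<kappa>\<close>, and contains a set \<open>W\<close> with
  \<open>2\<^bsup>|W|\<^esup> < \<kappa>\<close> such that every colouring of \<open>W\<close> by \<open>\<sigma>\<close> is constant with some value \<open>j\<close> on a
  \<open>j\<close>-homogeneous subset of type \<open>\<xi>\<close>. Take \<open>\<sigma>\<close> without repetitions and maximal such that it is
  positive at stationarily many nodes of every stationary subset of some stationary set. By
  maximality there are \<open>t\<close> and \<open>W\<close> above \<open>t\<close> such that, up to a null set at \<open>t\<close>, nodes below \<open>t\<close>
  have only colours from \<open>\<sigma>\<close> towards \<open>W\<close>. Since \<open>2\<^bsup>|W|\<^esup> < \<kappa>\<close>, on a positive set these colours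
  depend only on the element of \<open>W\<close>, and the two homogeneous sets fit together.
\<close>

section \<open>Ordinal sums and increasing maps\<close>

lemma ord_sum_iff [simp]:
  "(Inl a, Inl a') \<in> ord_sum r s \<longleftrightarrow> (a, a') \<in> r"
  "(Inr b, Inr b') \<in> ord_sum r s \<longleftrightarrow> (b, b') \<in> s"
  "(Inl a, Inr b) \<in> ord_sum r s \<longleftrightarrow> a \<in> Field r \<and> b \<in> Field s"
  "(Inr b, Inl a) \<notin> ord_sum r s"
  by (auto simp: ord_sum_def)

lemma Field_ord_sum: "Field (ord_sum r s) = Inl ` Field r \<union> Inr ` Field s"
proof (intro equalityI subsetI)
  fix x assume "x \<in> Field (ord_sum r s)"
  then show "x \<in> Inl ` Field r \<union> Inr ` Field s"
    unfolding Field_def[of "ord_sum r s"] Domain_iff Range_iff Un_iff split_sum_ex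
    by (cases x) (auto intro: FieldI1 FieldI2)
next
  fix x assume "x \<in> Inl ` Field r \<union> Inr ` Field s"
  then show "x \<in> Field (ord_sum r s)"
    unfolding Field_def Domain_iff Range_iff Un_iff split_sum_ex image_iff Bex_def
    by (cases x) (simp_all, blast+)
qed

lemma Well_order_ord_sum:
  assumes r: "Well_order r" and s: "Well_order s"
  shows "Well_order (ord_sum r s)"
proof -
  have r': "Refl r" "trans r" "antisym r" "Total r" "wf (r - Id)"
    and s': "Refl s" "trans s" "antisym s" "Total s" "wf (s - Id)"
    using r s by (auto simp: well_order_on_def linear_order_on_def partial_order_on_def preorder_on_def)
  have "Refl (ord_sum r s)"
    using r'(1) s'(1) unfolding refl_on_def Field_ord_sum by auto
  moreover have "trans (ord_sum r s)"
  proof (rule transI)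
    fix x y z assume "(x, y) \<in> ord_sum r s" "(y, z) \<in> ord_sum r s"
    then show "(x, z) \<in> ord_sum r s"
      by (cases x; cases y; cases z) (auto intro: FieldI1 FieldI2 transD[OF r'(2)] transD[OF s'(2)])
  qed
  moreover have "antisym (ord_sum r s)"
  proof (rule antisymI)
    fix x y assume "(x, y) \<in> ord_sum r s" "(y, x) \<in> ord_sum r s"
    then show "x = y"
      by (cases x; cases y) (auto intro: antisymD[OF r'(3)] antisymD[OF s'(3)])
  qed
  moreover have "Total (ord_sum r s)"
    unfolding total_on_def
  proof (intro ballI impI)
    fix x y assume "x \<in> Field (ord_sum r s)" "y \<in> Field (ord_sum r s)" "x \<noteq> y"
    then show "(x, y) \<in> ord_sum r s \<or> (y, x) \<in> ord_sum r s"
      using r'(4) s'(4) by (cases x; cases y) (auto simp: Field_ord_sum total_on_def)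
  qed
  moreover have "wf (ord_sum r s - Id)"
  proof (rule wfI_min)
    fix x and Q :: "('a + 'b) set" assume x: "x \<in> Q"
    show "\<exists>z\<in>Q. \<forall>y. (y, z) \<in> ord_sum r s - Id \<longrightarrow> y \<notin> Q"
    proof (cases "Inl -` Q = {}")
      case False
      then obtain a where "a \<in> Inl -` Q" "\<And>b. (b, a) \<in> r - Id \<Longrightarrow> b \<notin> Inl -` Q"
        using wfE_min'[OF r'(5)] by metis
      then show ?thesis by (intro bexI[of _ "Inl a"]) (auto simp: ord_sum_def)
    next
      case True
      then have "Inr -` Q \<noteq> {}" using x by (cases x) auto
      then obtain a where "a \<in> Inr -` Q" "\<And>b. (b, a) \<in> s - Id \<Longrightarrow> b \<notin> Inr -` Q"
        using wfE_min'[OF s'(5)] by metis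
      with True show ?thesis by (intro bexI[of _ "Inr a"]) (auto simp: ord_sum_def)
    qed
  qed
  moreover have "ord_sum r s \<subseteq> Field (ord_sum r s) \<times> Field (ord_sum r s)"
    by (auto intro: FieldI1 FieldI2)
  ultimately show ?thesis
    by (simp add: order_on_defs)
qed

text \<open>As \<open>\<rho>\<close> is total, a strictly increasing map also reflects the
  order.\<close>

lemma strictly_increasing_image:
  assumes po: "partial_order_on T r" and wo: "Well_order \<rho>" and T: "\<phi> ` Field \<rho> \<subseteq> T"
    and inc: "\<And>a b. (a, b) \<in> \<rho> \<Longrightarrow> a \<noteq> b \<Longrightarrow> \<phi> a \<in> underS r (\<phi> b)"
  shows "Restr r (\<phi> ` Field \<rho>) =o \<rho>" "\<phi> ` Field \<rho> \<in> Chains r"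
proof -
  have refl: "\<And>x. x \<in> T \<Longrightarrow> (x, x) \<in> r" and anti: "antisym r"
    using po by (auto simp: partial_order_on_def preorder_on_def refl_on_def)
  have total: "(a, b) \<in> \<rho> \<or> (b, a) \<in> \<rho>" if "a \<in> Field \<rho>" "b \<in> Field \<rho>" for a b
    using wo that by (cases "a = b")
      (auto simp: well_order_on_def linear_order_on_def partial_order_on_def preorder_on_def refl_on_def total_on_def)
  have mono: "(\<phi> a, \<phi> b) \<in> r" if "(a, b) \<in> \<rho>" for a b
  proof (cases "a = b")
    case True
    then have "\<phi> a \<in> T" using that T by (auto intro: FieldI1)
    then show ?thesis using True refl by simp
  next
    case False
    then show ?thesis using inc[OF that] by (simp add: underS_def)
  qed
  have inj: "inj_on \<phi> (Field \<rho>)"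
  proof (rule inj_onI, rule ccontr)
    fix a b assume "a \<in> Field \<rho>" "b \<in> Field \<rho>" "\<phi> a = \<phi> b" "a \<noteq> b"
    then show False
      using total[of a b] inc[of a b] inc[of b a] by (auto simp: underS_def)
  qed
  have conv: "(a, b) \<in> \<rho>" if "a \<in> Field \<rho>" "b \<in> Field \<rho>" "(\<phi> a, \<phi> b) \<in> r" for a b
  proof (rule ccontr)
    assume "(a, b) \<notin> \<rho>"
    then have "(b, a) \<in> \<rho>" "a \<noteq> b" using total[of a b] total[of a a] that by auto
    then show False
      using inc[of b a] antisymD[OF anti that(3)] by (auto simp: underS_def)
  qed
  have "Restr r (\<phi> ` Field \<rho>) = dir_image \<rho> \<phi>"
  proof (intro equalityI subsetI)
    fix p assume "p \<in> Restr r (\<phi> ` Field \<rho>)"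
    then show "p \<in> dir_image \<rho> \<phi>"
      using conv by (auto simp: dir_image_def)
  next
    fix p assume "p \<in> dir_image \<rho> \<phi>"
    then show "p \<in> Restr r (\<phi> ` Field \<rho>)"
      using mono by (auto simp: dir_image_def intro: FieldI1 FieldI2)
  qed
  then show "Restr r (\<phi> ` Field \<rho>) =o \<rho>"
    using dir_image_ordIso[OF wo inj] ordIso_symmetric by simp
  show "\<phi> ` Field \<rho> \<in> Chains r"
    using mono total by (force simp: Chains_def)
qed

section \<open>Small sets for a regular cardinal\<close>

locale regular_cardinal =
  fixes \<kappa> :: "'k rel"
  assumes Card_order: "Card_order \<kappa>" and cinfinite: "cinfinite \<kappa>" and regular: "regularCard \<kappa>"
begin

abbreviation small :: "'b set \<Rightarrow> bool" where
  "small A \<equiv> |A| <o \<kappa>"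

text \<open>By regularity these are exactly the bounded subsets of \<open>\<kappa>\<close>, a
  concrete set standing for the cardinal 2^(<\<kappa>).\<close>

definition bounded_sets :: "'k set set" where
  "bounded_sets = {A. A \<subseteq> Field \<kappa> \<and> small A}"

lemma Cinfinite: "Cinfinite \<kappa>"
  using Card_order cinfinite by simp

lemma infinite_Field: "infinite (Field \<kappa>)"
  using cinfinite by (simp add: cinfinite_def)

lemma small_finite: "finite A \<Longrightarrow> small A"
  using Cfinite_ordLess_Cinfinite[OF _ Cinfinite, of "|A|"]
  by (simp add: cfinite_def card_of_card_order_on Field_card_of)

lemma small_subset: "small B \<Longrightarrow> A \<subseteq> B \<Longrightarrow> small A"
  by (meson card_of_mono1 ordLeq_ordLess_trans)

lemma small_image: "small A \<Longrightarrow> small (f ` A)"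
  by (meson card_of_image ordLeq_ordLess_trans)

lemma small_Un: "small A \<Longrightarrow> small B \<Longrightarrow> small (A \<union> B)"
  using Un_Cinfinite_bound_strict Cinfinite by blast

lemma small_UN: "small I \<Longrightarrow> (\<And>i. i \<in> I \<Longrightarrow> small (A i)) \<Longrightarrow> small (\<Union>i\<in>I. A i)"
  by (rule card_of_UNION_ordLess_infinite_Field_regularCard[OF regular Cinfinite]) auto

lemma small_Times:
  assumes "small A" "small B"
  shows "small (A \<times> B)"
proof -
  have "A \<times> B = (\<Union>a\<in>A. Pair a ` B)" by auto
  then show ?thesis
    using small_UN[OF assms(1) small_image[OF assms(2)]] by simp
qed

lemma small_underS: "a \<in> Field \<kappa> \<Longrightarrow> small (underS \<kappa> a)"
  by (rule card_of_underS[OF Card_order])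

lemma small_bounded:
  assumes "A \<subseteq> Field \<kappa>" "small A"
  obtains a where "a \<in> Field \<kappa>" "A \<subseteq> underS \<kappa> a"
proof -
  have "\<not> cofinal A \<kappa>"
    using regular assms not_ordLess_ordIso unfolding regularCard_def by blast
  then obtain a where a: "a \<in> Field \<kappa>" "\<forall>b\<in>A. \<not> (a \<noteq> b \<and> (a, b) \<in> \<kappa>)"
    unfolding cofinal_def by blast
  \<comment> \<open>Non-cofinality bounds \<open>A\<close> only weakly by \<open>a\<close>; a larger
    \<open>a'\<close> makes the bound strict.\<close>
  obtain a' where a': "a' \<in> Field \<kappa>" "a \<noteq> a'" "(a, a') \<in> \<kappa>"
    using infinite_Card_order_limit[OF Card_order infinite_Field a(1)] by blast
  have total: "Total \<kappa>" and "Refl \<kappa>" and trans: "trans \<kappa>" and anti: "antisym \<kappa>"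
    using Card_order by (simp_all add: card_order_on_def order_on_defs)
  have "b \<in> underS \<kappa> a'" if "b \<in> A" for b
  proof -
    have "b \<in> Field \<kappa>" and "b = a \<or> (a, b) \<notin> \<kappa>"
      using assms(1) that a(2) by auto
    then have "(b, a) \<in> \<kappa>"
      using a(1) total \<open>Refl \<kappa>\<close> by (metis refl_onD total_on_def)
    then show ?thesis
      using a' transD[OF trans] antisymD[OF anti] unfolding underS_def by blast
  qed
  with a' that show ?thesis by blast
qed

lemma inj_into_Field:
  assumes "small A"
  obtains h where "inj_on h A" "h ` A \<subseteq> Field \<kappa>"
proof -
  have "|A| \<le>o |Field \<kappa>|"
    using assms card_of_Field_ordIso[OF Card_order]
    by (meson ordIso_symmetric ordLeq_ordIso_trans ordLess_imp_ordLeq)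
  then show ?thesis using that by (auto simp: card_of_ordLeq[symmetric])
qed

section \<open>Cardinal arithmetic of 2^(<\<kappa>)\<close>

lemma infinite_bounded_sets: "infinite bounded_sets"
proof
  assume "finite bounded_sets"
  moreover have "(\<lambda>a. {a}) ` Field \<kappa> \<subseteq> bounded_sets"
    by (auto simp: bounded_sets_def small_finite)
  ultimately have "finite ((\<lambda>a. {a}) ` Field \<kappa>)"
    by (rule rev_finite_subset)
  then show False
    using infinite_Field by (auto dest: finite_imageD)
qed

lemma card_Pow_small:
  assumes "small A" shows "|Pow A| \<le>o |bounded_sets|"
proof -
  obtain h where h: "inj_on h A" "h ` A \<subseteq> Field \<kappa>"
    using inj_into_Field[OF assms] .
  have "inj_on ((`) h) (Pow A)"
    using h(1) by (rule inj_on_image_Pow)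
  moreover have "(`) h ` Pow A \<subseteq> bounded_sets"
    using h(2) small_image[OF small_subset[OF assms]] unfolding bounded_sets_def by blast
  ultimately show ?thesis unfolding card_of_ordLeq[symmetric] by blast
qed

lemma card_Sigma_bounded_sets:
  "|I| \<le>o |bounded_sets| \<Longrightarrow> (\<And>i. i \<in> I \<Longrightarrow> |A i| \<le>o |bounded_sets| ) \<Longrightarrow> |Sigma I A| \<le>o |bounded_sets|"
  by (intro card_of_Sigma_ordLeq_infinite[OF infinite_bounded_sets]) blast+

lemma card_finite_bounded_sets: "finite A \<Longrightarrow> |A| \<le>o |bounded_sets|"
  using finite_ordLess_infinite[OF card_of_Well_order card_of_Well_order, of A bounded_sets]
    infinite_bounded_sets by (simp add: Field_card_of ordLess_imp_ordLeq)

text \<open>A small family is indexed injectively by elements of \<open>Field \<kappa>\<close> and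
  coded by its index set together with the disjoint union of its members, folded into
  \<open>\<kappa>\<close> by the pairing \<open>J\<close>. Regularity keeps this union
  small.\<close>

lemma card_small_subsets_bounded_sets:
  "|{A. A \<subseteq> bounded_sets \<and> small A}| \<le>o |bounded_sets|"
proof -
  let ?S = "{A. A \<subseteq> bounded_sets \<and> small A}"
  have "|Field \<kappa> \<times> Field \<kappa>| \<le>o |Field \<kappa>|"
    using card_of_Times_same_infinite[OF infinite_Field] ordIso_iff_ordLeq by blast
  then obtain J where J: "inj_on J (Field \<kappa> \<times> Field \<kappa>)" "J ` (Field \<kappa> \<times> Field \<kappa>) \<subseteq> Field \<kappa>"
    by (auto simp: card_of_ordLeq[symmetric])
  define h where "h A = (SOME h. inj_on h A \<and> h ` A \<subseteq> Field \<kappa>)" for A :: "'k set set"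
  have h: "inj_on (h A) A" "h A ` A \<subseteq> Field \<kappa>" if "A \<in> ?S" for A
  proof -
    from that have "\<exists>g. inj_on g A \<and> g ` A \<subseteq> Field \<kappa>" by (auto elim: inj_into_Field)
    from someI_ex[OF this] show "inj_on (h A) A" "h A ` A \<subseteq> Field \<kappa>"
      by (simp_all add: h_def)
  qed
  \<comment> \<open>The index set is recorded separately because an empty member leaves no trace in
    the disjoint union. \<open>\<Psi>\<close> recovers the members as sections.\<close>
  define \<Phi> where "\<Phi> A = (h A ` A, \<Union>x\<in>A. (\<lambda>y. J (h A x, y)) ` x)" for A
  define \<Psi> where "\<Psi> p = (\<lambda>i. {y\<in>Field \<kappa>. J (i, y) \<in> snd p}) ` fst p" for p
  have decode: "\<Psi> (\<Phi> A) = A" if A: "A \<in> ?S" for A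
  proof -
    have "{y\<in>Field \<kappa>. J (h A x, y) \<in> snd (\<Phi> A)} = x" if "x \<in> A" for x
    proof (intro equalityI subsetI)
      fix y assume "y \<in> x"
      then show "y \<in> {y\<in>Field \<kappa>. J (h A x, y) \<in> snd (\<Phi> A)}"
        using that A unfolding \<Phi>_def bounded_sets_def by auto
    next
      fix y assume "y \<in> {y\<in>Field \<kappa>. J (h A x, y) \<in> snd (\<Phi> A)}"
      then obtain x' y' where y: "y \<in> Field \<kappa>" "x' \<in> A" "y' \<in> x'" "J (h A x, y) = J (h A x', y')"
        by (auto simp: \<Phi>_def)
      have "y' \<in> Field \<kappa>" "h A x \<in> Field \<kappa>" "h A x' \<in> Field \<kappa>"
        using y that A h(2)[OF A] by (auto simp: bounded_sets_def)
      then have "(h A x, y) = (h A x', y')"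
        using y(1) by (intro inj_onD[OF J(1) y(4)]) simp_all
      moreover from this have "x = x'"
        using that y(2) by (intro inj_onD[OF h(1)[OF A]]) simp_all
      ultimately show "y \<in> x"
        using y(3) by simp
    qed
    then have "(\<lambda>x. {y\<in>Field \<kappa>. J (h A x, y) \<in> snd (\<Phi> A)}) ` A = A"
      by simp
    moreover have "fst (\<Phi> A) = h A ` A"
      by (simp add: \<Phi>_def)
    ultimately show ?thesis
      by (simp only: \<Psi>_def image_image)
  qed
  have "inj_on \<Phi> ?S"
    using decode by (rule inj_on_inverseI)
  moreover have "\<Phi> A \<in> bounded_sets \<times> bounded_sets" if "A \<in> ?S" for A
  proof -
    have "small (\<Union>x\<in>A. (\<lambda>y. J (h A x, y)) ` x)"
      using that by (intro small_UN small_image) (auto simp: bounded_sets_def)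
    moreover have "(\<Union>x\<in>A. (\<lambda>y. J (h A x, y)) ` x) \<subseteq> Field \<kappa>"
    proof (intro UN_least image_subsetI)
      fix x y assume "x \<in> A" "y \<in> x"
      then have "(h A x, y) \<in> Field \<kappa> \<times> Field \<kappa>"
        using that h(2)[OF that] by (auto simp: bounded_sets_def)
      then show "J (h A x, y) \<in> Field \<kappa>"
        using J(2) by blast
    qed
    moreover have "small (h A ` A)" using that by (simp add: small_image)
    ultimately show ?thesis
      using h(2)[OF that] by (simp add: \<Phi>_def bounded_sets_def)
  qed
  ultimately have "|?S| \<le>o |bounded_sets \<times> bounded_sets|"
    by (rule card_of_ordLeqI)
  also have "|bounded_sets \<times> bounded_sets| \<le>o |bounded_sets|"
    by (intro card_Sigma_bounded_sets ordLeq_refl card_of_Card_order)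
  finally show ?thesis .
qed

text \<open>Each small set lies in the power set of a proper initial segment, so a union of
  \<open>\<kappa>\<close> many power sets covers everything.\<close>

lemma card_bounded_sets_le: "|bounded_sets| \<le>o weak_cexp ctwo \<kappa>"
proof -
  define R where "R = {ctwo ^c \<mu> | \<mu> :: 'k rel. Card_order \<mu> \<and> \<mu> <o \<kappa>}"
  have "is_card_Sup R (weak_cexp ctwo \<kappa>)"
    unfolding weak_cexp_def R_def by (rule is_card_Sup_card_Sup) (auto simp: Card_order_cexp)
  then have co: "Card_order (weak_cexp ctwo \<kappa>)" and ub: "\<And>s. s \<in> R \<Longrightarrow> s \<le>o weak_cexp ctwo \<kappa>"
    by (auto simp: is_card_Sup_def)
  have Pow: "|Pow A| \<le>o weak_cexp ctwo \<kappa>" if "small A" for A :: "'k set"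
  proof -
    have "ctwo ^c |A| \<in> R"
      using that card_of_Card_order by (auto simp: R_def)
    moreover have "|Pow A| =o ctwo ^c |A|"
      using card_of_Pow_Func[of A] by (simp add: cexp_def ctwo_def Field_card_of)
    ultimately show ?thesis
      using ub ordIso_ordLeq_trans by blast
  qed
  \<comment> \<open>Cantor: a weak power below \<open>\<kappa>\<close> would be \<open>|A|\<close>
    for a small \<open>A\<close>, but it also bounds \<open>|Pow A|\<close>.\<close>
  have "\<kappa> \<le>o weak_cexp ctwo \<kappa>"
  proof (rule ccontr)
    let ?\<nu> = "weak_cexp ctwo \<kappa>"
    assume "\<not> \<kappa> \<le>o ?\<nu>"
    then have less: "?\<nu> <o \<kappa>"
      using co Card_order by (simp add: card_order_on_def not_ordLeq_iff_ordLess)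
    then have "|Field ?\<nu>| <o \<kappa>"
      using card_of_Field_ordIso[OF co] ordIso_ordLess_trans by blast
    then obtain A :: "'k set" where A: "|Field ?\<nu>| =o |A|" "|A| <o \<kappa>"
      using internalize_card_of_ordLess[of "Field ?\<nu>" \<kappa>] by auto
    have "?\<nu> =o |A|"
      using A(1) card_of_Field_ordIso[OF co] ordIso_symmetric ordIso_transitive by blast
    also have "|A| <o |Pow A|" by (rule card_of_Pow)
    also have "|Pow A| \<le>o ?\<nu>" by (rule Pow[OF A(2)])
    finally show False by (simp add: ordLess_irreflexive)
  qed
  then have inf: "Cinfinite (weak_cexp ctwo \<kappa>)"
    using co cinfinite cinfinite_mono by blast
  have "bounded_sets \<subseteq> (\<Union>a\<in>Field \<kappa>. Pow (underS \<kappa> a))"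
  proof
    fix A assume "A \<in> bounded_sets"
    then obtain a where "a \<in> Field \<kappa>" "A \<subseteq> underS \<kappa> a"
      unfolding bounded_sets_def by (auto elim: small_bounded)
    then show "A \<in> (\<Union>a\<in>Field \<kappa>. Pow (underS \<kappa> a))" by blast
  qed
  then have "|bounded_sets| \<le>o |\<Union>a\<in>Field \<kappa>. Pow (underS \<kappa> a)|"
    by (rule card_of_mono1)
  also have "|\<Union>a\<in>Field \<kappa>. Pow (underS \<kappa> a)| \<le>o weak_cexp ctwo \<kappa>"
    using \<open>\<kappa> \<le>o weak_cexp ctwo \<kappa>\<close> Pow small_underS card_of_Field_ordIso[OF Card_order] ordIso_ordLeq_trans
    by (intro UNION_Cinfinite_bound[OF _ _ inf]) blast+
  finally show ?thesis .
qed

end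

section \<open>Stationary subsets of trees\<close>

locale regular_tree = regular_cardinal \<kappa> for \<kappa> :: "'k rel" +
  fixes T :: "'a set" and r :: "'a rel"
  assumes tree: "tree_on T r"
begin

lemma underS_trans: "u \<in> underS r v \<Longrightarrow> v \<in> underS r t \<Longrightarrow> u \<in> underS r t"
  using tree unfolding tree_on_def partial_order_on_def preorder_on_def underS_def
  by (auto dest: transD antisymD)

lemma underS_in_tree: "u \<in> underS r t \<Longrightarrow> u \<in> T \<and> t \<in> T"
  using tree unfolding tree_on_def partial_order_on_def preorder_on_def underS_def by blast

lemma underS_total:
  assumes "u \<in> underS r t" "v \<in> underS r t"
  shows "u = v \<or> u \<in> underS r v \<or> v \<in> underS r u"
proof -
  have "well_order_on (underS r t) (Restr r (underS r t))"
    using tree underS_in_tree[OF assms(1)] by (simp add: tree_on_def)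
  then have "total_on (underS r t) (Restr r (underS r t))"
    by (simp add: order_on_defs)
  with assms show ?thesis
    by (auto simp: total_on_def underS_def)
qed

lemma wf_underS: "wf {(u, t). u \<in> underS r t}"
proof (rule wfI_min)
  fix t and Q :: "'a set" assume "t \<in> Q"
  show "\<exists>z\<in>Q. \<forall>y. (y, z) \<in> {(u, t). u \<in> underS r t} \<longrightarrow> y \<notin> Q"
  proof (cases "Q \<inter> underS r t = {}")
    case True
    with \<open>t \<in> Q\<close> show ?thesis by blast
  next
    case False
    then have "well_order_on (underS r t) (Restr r (underS r t))"
      using tree underS_in_tree by (auto simp: tree_on_def)
    then have "wf (Restr r (underS r t) - Id)"
      by (simp add: well_order_on_def)
    then obtain z where z: "z \<in> Q \<inter> underS r t"
      "\<And>y. (y, z) \<in> Restr r (underS r t) - Id \<Longrightarrow> y \<notin> Q \<inter> underS r t"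
      using False by (metis wfE_min ex_in_conv)
    have "y \<notin> Q" if "y \<in> underS r z" for y
    proof
      assume "y \<in> Q"
      have "y \<in> underS r t" using that z(1) underS_trans by blast
      then show False
        using z \<open>y \<in> Q\<close> that by (auto simp: underS_def)
    qed
    with z(1) show ?thesis by blast
  qed
qed

text \<open>
  A diagonal union of special sets, except that the pressing function takes values in the sets of
  fewer than \<open>\<kappa>\<close> predecessors rather than in the predecessors. This makes the nodes whose height
  has cofinality below \<open>\<kappa>\<close> nonstationary, since a cofinal set of predecessors can be pressed.
  The set \<open>bounded_sets\<close>, of size \<open>2\<^sup><\<^sup>\<kappa>\<close>, serves as a set of labels for antichains.
\<close>

definition nonstationary :: "'a set \<Rightarrow> bool" where
  "nonstationary S \<longleftrightarrow> (\<exists>f g. \<forall>t\<in>S. f t \<subseteq> underS r t \<and> small (f t) \<and> g t \<in> bounded_sets \<and>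
     (\<forall>u\<in>S. u \<in> underS r t \<longrightarrow> f u \<noteq> f t \<or> g u \<noteq> g t))"

lemma nonstationary_subset: "nonstationary S \<Longrightarrow> S' \<subseteq> S \<Longrightarrow> nonstationary S'"
  unfolding nonstationary_def by (meson subsetD)

text \<open>Every node is pressed to the empty set. Used contrapositively: a stationary set contains
  two comparable nodes.\<close>

lemma nonstationary_antichain:
  assumes "\<And>t u. t \<in> S \<Longrightarrow> u \<in> S \<Longrightarrow> u \<notin> underS r t"
  shows "nonstationary S"
  unfolding nonstationary_def
  using assms by (intro exI[of _ "\<lambda>_. {}"]) (auto simp: bounded_sets_def small_finite)

text \<open>A pressing-down lemma with a second datum \<open>q\<close> whose range may depend on the
  pressed set. If all fibres were nonstationary, their witnesses would merge into one witness for
  \<open>S\<close>.\<close>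

lemma stationary_press:
  assumes "\<not> nonstationary S"
    and f: "\<And>t. t \<in> S \<Longrightarrow> f t \<subseteq> underS r t" "\<And>t. t \<in> S \<Longrightarrow> small (f t)"
    and q: "\<And>t. t \<in> S \<Longrightarrow> q t \<in> Q (f t)"
    and Q: "\<And>b. small b \<Longrightarrow> |Q b| \<le>o |bounded_sets|"
  obtains b z where "\<not> nonstationary {t \<in> S. f t = b \<and> q t = z}"
proof -
  define S' where "S' b z = {t \<in> S. f t = b \<and> q t = z}" for b z
  have "nonstationary S" if ns: "\<And>b z. nonstationary (S' b z)"
  proof -
    have "\<exists>F G. \<forall>t\<in>S' b z. F t \<subseteq> underS r t \<and> small (F t) \<and> G t \<in> bounded_sets \<and>
        (\<forall>u\<in>S' b z. u \<in> underS r t \<longrightarrow> F u \<noteq> F t \<or> G u \<noteq> G t)" for b z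
      using ns unfolding nonstationary_def by simp
    then obtain F G where FG: "\<And>b z. \<forall>t\<in>S' b z. F b z t \<subseteq> underS r t \<and> small (F b z t) \<and>
        G b z t \<in> bounded_sets \<and> (\<forall>u\<in>S' b z. u \<in> underS r t \<longrightarrow> F b z u \<noteq> F b z t \<or> G b z u \<noteq> G b z t)"
      by metis
    define F' where "F' t = F (f t) (q t) t" for t
    define G' where "G' t = G (f t) (q t) t" for t
    \<comment> \<open>The merged pressing set; what the union forgets goes into the label, which
      codes \<open>d t\<close>. \<open>D b\<close> holds the tuples possible when
      \<open>h t = b\<close>, few enough to be coded because a small \<open>b\<close> has at most
      \<open>|bounded_sets|\<close> subsets.\<close>
    define h where "h t = f t \<union> F' t" for t
    define D where "D b = (SIGMA b1 : Pow b. Pow b \<times> Q b1 \<times> bounded_sets)" for b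
    have "\<exists>e. inj_on e (D b) \<and> e ` D b \<subseteq> bounded_sets" if "small b" for b
    proof -
      have "|D b| \<le>o |bounded_sets|"
        unfolding D_def
        using small_subset[OF that]
        by (intro card_Sigma_bounded_sets card_Pow_small[OF that] Q ordLeq_refl card_of_Card_order) auto
      then show ?thesis by (simp add: card_of_ordLeq)
    qed
    then obtain e where e: "\<And>b. small b \<Longrightarrow> inj_on (e b) (D b)" "\<And>b. small b \<Longrightarrow> e b ` D b \<subseteq> bounded_sets"
      by metis
    define d where "d t = (f t, F' t, q t, G' t)" for t
    have FG': "F' t \<subseteq> underS r t" "small (F' t)" "G' t \<in> bounded_sets" if "t \<in> S" for t
      using FG[of "f t" "q t"] that by (auto simp: F'_def G'_def S'_def)
    have h: "h t \<subseteq> underS r t" "small (h t)" if "t \<in> S" for t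
      using FG'[OF that] f[OF that] by (auto simp: h_def small_Un)
    have d: "d t \<in> D (h t)" if "t \<in> S" for t
      using FG'[OF that] q[OF that] by (auto simp: d_def D_def h_def)
    \<comment> \<open>Equal sets and labels decode to equal tuples, so \<open>u\<close> and
      \<open>t\<close> lie in one fibre, whose witness separates them.\<close>
    have "h u \<noteq> h t \<or> e (h u) (d u) \<noteq> e (h t) (d t)" if tu: "t \<in> S" "u \<in> S" "u \<in> underS r t" for t u
    proof (rule ccontr)
      assume "\<not> (h u \<noteq> h t \<or> e (h u) (d u) \<noteq> e (h t) (d t))"
      then have "d u = d t"
        using d[OF tu(1)] d[OF tu(2)] inj_onD[OF e(1)[OF h(2)[OF tu(1)]]] by simp
      then have eq: "f u = f t" "F' u = F' t" "q u = q t" "G' u = G' t"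
        by (simp_all add: d_def)
      have "t \<in> S' (f t) (q t)" "u \<in> S' (f t) (q t)"
        using tu eq by (simp_all add: S'_def)
      then have "F (f t) (q t) u \<noteq> F (f t) (q t) t \<or> G (f t) (q t) u \<noteq> G (f t) (q t) t"
        using FG tu(3) by blast
      then show False
        using eq by (simp add: F'_def G'_def)
    qed
    moreover have "e (h t) (d t) \<in> bounded_sets" if "t \<in> S" for t
      using e(2)[OF h(2)[OF that]] d[OF that] by blast
    ultimately show ?thesis
      unfolding nonstationary_def using h
      by (intro exI[of _ h] exI[of _ "\<lambda>t. e (h t) (d t)"]) blast
  qed
  with assms(1) show ?thesis
    using that unfolding S'_def by blast
qed

lemma stationary_UN:
  assumes "\<not> nonstationary S" "finite I" "S \<subseteq> (\<Union>i\<in>I. A i)"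
  obtains i where "i \<in> I" "\<not> nonstationary (S \<inter> A i)"
proof -
  have "\<exists>i. i \<in> I \<and> t \<in> A i" if "t \<in> S" for t
    using that assms(3) by blast
  then obtain q where q: "\<And>t. t \<in> S \<Longrightarrow> q t \<in> I \<and> t \<in> A (q t)"
    by metis
  show thesis
  proof (rule stationary_press[OF assms(1), of "\<lambda>_. {}" q "\<lambda>_. I"])
    show "q t \<in> I" if "t \<in> S" for t using q[OF that] ..
  next
    fix b z assume bz: "\<not> nonstationary {t \<in> S. {} = b \<and> q t = z}"
    then have "{t \<in> S. {} = b \<and> q t = z} \<noteq> {}"
      using nonstationary_antichain[of "{t \<in> S. {} = b \<and> q t = z}"] by blast
    then have "z \<in> I" "{t \<in> S. {} = b \<and> q t = z} \<subseteq> S \<inter> A z"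
      using q by auto
    with bz show thesis
      using that[of z] nonstationary_subset by blast
  qed (simp_all add: small_finite card_finite_bounded_sets assms(2))
qed

lemma nonstationary_Un:
  assumes "nonstationary A" "nonstationary B"
  shows "nonstationary (A \<union> B)"
proof (rule ccontr)
  assume "\<not> nonstationary (A \<union> B)"
  then obtain i where "\<not> nonstationary ((A \<union> B) \<inter> (if i then A else B))"
    by (rule stationary_UN[where I = UNIV and A = "\<lambda>i. if i then A else B"]) (auto split: if_splits)
  with assms show False
    by (auto split: if_splits dest: nonstationary_subset)
qed

text \<open>Turns the hypothesis that \<open>T\<close> is not special into stationarity of
  \<open>T\<close>, the form used from here on.\<close>

lemma special_if_nonstationary:
  assumes "nonstationary T"
  shows "special_tree (weak_cexp ctwo \<kappa>) T r"
proof -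
  obtain f g where fg: "\<And>t. t \<in> T \<Longrightarrow> f t \<subseteq> underS r t" "\<And>t. t \<in> T \<Longrightarrow> small (f t)"
      "\<And>t. t \<in> T \<Longrightarrow> g t \<in> bounded_sets"
      "\<And>t u. t \<in> T \<Longrightarrow> u \<in> underS r t \<Longrightarrow> f u \<noteq> f t \<or> g u \<noteq> g t"
    using assms underS_in_tree unfolding nonstationary_def by metis
  \<comment> \<open>The antichain of \<open>t\<close> is coded by its label and the codes of the nodes in \<open>f t\<close>; the codes
    fit into \<open>bounded_sets\<close> because \<open>(2\<^sup><\<^sup>\<kappa>)\<^sup><\<^sup>\<kappa> = 2\<^sup><\<^sup>\<kappa>\<close>.\<close>
  let ?D = "bounded_sets \<times> {A. A \<subseteq> bounded_sets \<and> small A}"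
  have "|?D| \<le>o |bounded_sets|"
    by (intro card_Sigma_bounded_sets card_small_subsets_bounded_sets ordLeq_refl card_of_Card_order)
  then obtain \<Phi> where \<Phi>: "inj_on \<Phi> ?D" "\<Phi> ` ?D \<subseteq> bounded_sets"
    by (auto simp: card_of_ordLeq[symmetric])
  define code where "code = wfrec {(u, t). u \<in> underS r t} (\<lambda>h t. \<Phi> (g t, h ` f t))"
  have code: "code t = \<Phi> (g t, code ` f t)" if "t \<in> T" for t
  proof -
    have "code t = \<Phi> (g t, cut code {(u, t). u \<in> underS r t} t ` f t)"
      unfolding code_def by (subst wfrec[OF wf_underS]) simp
    also have "cut code {(u, t). u \<in> underS r t} t ` f t = code ` f t"
      using fg(1)[OF that] by (intro image_cong) (auto simp: cut_apply)
    finally show ?thesis .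
  qed
  have code_in: "t \<in> T \<longrightarrow> code t \<in> bounded_sets" for t
  proof (induction t rule: wf_induct_rule[OF wf_underS])
    case (1 t)
    have "(g t, code ` f t) \<in> ?D" if "t \<in> T"
      using 1 fg(1-3)[OF that] underS_in_tree by (auto simp: small_image)
    then show ?case
      using code \<Phi>(2) by auto
  qed
  have args: "(g t, code ` f t) \<in> ?D" if "t \<in> T" for t
    using code_in fg(1-3)[OF that] underS_in_tree by (auto simp: small_image)
  \<comment> \<open>Comparability is stated symmetrically so that the induction hypothesis at
    \<open>s\<close> below \<open>t\<close> applies whichever of \<open>s\<close> and
    \<open>s'\<close> is lower.\<close>
  have code_eq: "\<forall>t'. t' \<in> T \<and> t \<in> T \<and> (t \<in> underS r t' \<or> t' \<in> underS r t) \<longrightarrow> code t \<noteq> code t'" for t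
  proof (induction t rule: wf_induct_rule[OF wf_underS])
    case (1 t)
    show ?case
    proof (intro allI impI notI)
      fix t' assume t': "t' \<in> T \<and> t \<in> T \<and> (t \<in> underS r t' \<or> t' \<in> underS r t)" "code t = code t'"
      then have eq: "g t = g t'" "code ` f t = code ` f t'"
        using inj_onD[OF \<Phi>(1) _ args args, of t t'] code by auto
      \<comment> \<open>All nodes involved lie below the larger of \<open>t\<close> and \<open>t'\<close>, hence are comparable.\<close>
      have same: "s = s'" if s: "s \<in> f t" "s' \<in> f t'" "code s = code s'" for s s'
      proof (rule ccontr)
        assume "s \<noteq> s'"
        have "s \<in> underS r t" "s' \<in> underS r t'"
          using s t' fg(1) by blast+
        moreover from this have "s \<in> underS r s' \<or> s' \<in> underS r s"
          using t' \<open>s \<noteq> s'\<close> underS_total underS_trans by blast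
        ultimately show False
          using 1[of s] s(3) underS_in_tree by blast
      qed
      have "f t = f t'"
      proof
        show "f t \<subseteq> f t'"
        proof
          fix s assume "s \<in> f t"
          moreover from this obtain s' where "s' \<in> f t'" "code s = code s'"
            using eq(2) by blast
          ultimately show "s \<in> f t'" using same by blast
        qed
        show "f t' \<subseteq> f t"
        proof
          fix s' assume "s' \<in> f t'"
          moreover from this obtain s where "s \<in> f t" "code s = code s'"
            using eq(2) by (metis imageE imageI)
          ultimately show "s' \<in> f t" using same by blast
        qed
      qed
      then show False
        using t' eq(1) fg(4)[of t t'] fg(4)[of t' t] by auto
    qed
  qed
  define \<A> where "\<A> = (\<lambda>x. {t \<in> T. code t = x}) ` bounded_sets"
  have "|\<A>| \<le>o weak_cexp ctwo \<kappa>"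
    unfolding \<A>_def using card_of_image card_bounded_sets_le by (rule ordLeq_transitive)
  moreover have "antichain_in T r A" if "A \<in> \<A>" for A
    using that code_eq unfolding \<A>_def antichain_in_def underS_def by fastforce
  moreover have "\<Union>\<A> = T"
    using code_in by (auto simp: \<A>_def)
  ultimately show ?thesis
    unfolding special_tree_def by blast
qed

end

section \<open>Ideals determined by a colouring\<close>

locale coloured_tree = regular_tree \<kappa> T r for \<kappa> :: "'k rel" and T :: "'a set" and r :: "'a rel" +
  fixes c :: "'a \<Rightarrow> 'a \<Rightarrow> nat" and k :: nat
  assumes colour_less: "u \<in> underS r t \<Longrightarrow> c u t < k"
begin

text \<open>In model-theoretic terms, \<open>u\<close> realises the type of \<open>t\<close> over
  \<open>b\<close>. The inclusion puts \<open>u\<close> above all of \<open>b\<close>, so nodes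
  found by agreement can be stacked upwards.\<close>

definition agree :: "'a set \<Rightarrow> 'a \<Rightarrow> 'a \<Rightarrow> bool" where
  "agree b u t \<longleftrightarrow> b \<subseteq> underS r u \<and> (\<forall>y\<in>b. c y u = c y t)"

text \<open>
  The sets \<open>X\<close> of predecessors of \<open>t\<close> with \<open>\<not> reflects t X\<close> form the \<open>\<kappa>\<close>-complete ideal generated
  by the complements of the sets of nodes that have the same colours as \<open>t\<close> over a given small set.
\<close>

definition reflects :: "'a \<Rightarrow> 'a set \<Rightarrow> bool" where
  "reflects t X \<longleftrightarrow> (\<forall>b. b \<subseteq> underS r t \<and> small b \<longrightarrow> (\<exists>u\<in>X. u \<in> underS r t \<and> agree b u t))"

definition nbhd :: "nat \<Rightarrow> 'a \<Rightarrow> 'a set \<Rightarrow> 'a set" where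
  "nbhd i s X = {x \<in> X. x \<in> underS r s \<and> c x s = i}"

text \<open>
  Positivity for an iterated ideal: by \<open>homogeneous_below\<close> and \<open>homogeneous_above\<close>, a set that is
  positive for \<open>\<sigma>\<close> contains homogeneous sets for all the colours in \<open>\<sigma>\<close>.
\<close>

primrec pos :: "nat list \<Rightarrow> 'a \<Rightarrow> 'a set \<Rightarrow> bool" where
  "pos [] t X \<longleftrightarrow> reflects t X"
| "pos (i # \<sigma>) t X \<longleftrightarrow> reflects t {s. pos \<sigma> s (nbhd i s X)}"

lemma reflectsE:
  assumes "reflects t X" "b \<subseteq> underS r t" "small b"
  obtains u where "u \<in> X" "u \<in> underS r t" "agree b u t"
  using assms unfolding reflects_def by blast

lemma reflects_mono: "reflects t X \<Longrightarrow> X \<subseteq> Y \<Longrightarrow> reflects t Y"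
  unfolding reflects_def by (meson subsetD)

lemma pos_mono: "pos \<sigma> t X \<Longrightarrow> X \<subseteq> Y \<Longrightarrow> pos \<sigma> t Y"
proof (induction \<sigma> arbitrary: t X Y)
  case Nil
  then show ?case using reflects_mono by simp
next
  case (Cons i \<sigma>)
  have "pos \<sigma> s (nbhd i s Y)" if "pos \<sigma> s (nbhd i s X)" for s
    by (rule Cons.IH[OF that]) (use Cons.prems(2) in \<open>auto simp: nbhd_def\<close>)
  then have "{s. pos \<sigma> s (nbhd i s X)} \<subseteq> {s. pos \<sigma> s (nbhd i s Y)}" by blast
  with Cons.prems(1) show ?case using reflects_mono by simp
qed

text \<open>By regularity the parameter sets refuting the pieces unite to a small set, over which no
  node of any piece agrees with \<open>t\<close>.\<close>

lemma reflects_UN: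
  assumes "small I" "reflects t (\<Union>i\<in>I. A i)"
  shows "\<exists>i\<in>I. reflects t (A i)"
proof (rule ccontr)
  assume "\<not> (\<exists>i\<in>I. reflects t (A i))"
  then have "\<forall>i\<in>I. \<exists>b. b \<subseteq> underS r t \<and> small b \<and> (\<forall>u\<in>A i. u \<in> underS r t \<longrightarrow> \<not> agree b u t)"
    unfolding reflects_def by simp
  from bchoice[OF this] obtain b where b: "\<And>i. i \<in> I \<Longrightarrow> b i \<subseteq> underS r t" "\<And>i. i \<in> I \<Longrightarrow> small (b i)"
    "\<And>i u. i \<in> I \<Longrightarrow> u \<in> A i \<Longrightarrow> u \<in> underS r t \<Longrightarrow> \<not> agree (b i) u t"
    by blast
  have small: "small (\<Union>i\<in>I. b i)"
    using assms(1) b(2) by (rule small_UN)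
  have below: "(\<Union>i\<in>I. b i) \<subseteq> underS r t"
    using b(1) by blast
  obtain u where "u \<in> (\<Union>i\<in>I. A i)" and u: "u \<in> underS r t" "agree (\<Union>i\<in>I. b i) u t"
    using assms(2) below small by (rule reflectsE)
  then obtain i where "i \<in> I" "u \<in> A i" by blast
  moreover from this u have "agree (b i) u t"
    by (auto simp: agree_def)
  ultimately show False using b(3) u(1) by blast
qed

lemma pos_UN: "small I \<Longrightarrow> pos \<sigma> t (\<Union>i\<in>I. A i) \<Longrightarrow> \<exists>i\<in>I. pos \<sigma> t (A i)"
proof (induction \<sigma> arbitrary: t A)
  case Nil
  then show ?case by (simp add: reflects_UN)
next
  case (Cons j \<sigma>)
  have "\<exists>i\<in>I. pos \<sigma> s (nbhd j s (A i))" if "pos \<sigma> s (nbhd j s (\<Union>i\<in>I. A i))" for s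
  proof -
    have "nbhd j s (\<Union>i\<in>I. A i) = (\<Union>i\<in>I. nbhd j s (A i))"
      by (auto simp: nbhd_def)
    with that Cons.IH[OF Cons.prems(1), of s "\<lambda>i. nbhd j s (A i)"] show ?thesis by simp
  qed
  then have "{s. pos \<sigma> s (nbhd j s (\<Union>i\<in>I. A i))} \<subseteq> (\<Union>i\<in>I. {s. pos \<sigma> s (nbhd j s (A i))})"
    by blast
  then have "reflects t (\<Union>i\<in>I. {s. pos \<sigma> s (nbhd j s (A i))})"
    using reflects_mono Cons.prems(2) by simp
  with reflects_UN[OF Cons.prems(1)] show ?case by simp
qed

text \<open>Agreement passes down: if \<open>s\<close> agrees with \<open>t\<close> over
  \<open>b\<close>, and \<open>x\<close> below \<open>s\<close> agrees with \<open>s\<close> over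
  \<open>b\<close>, then \<open>x\<close> agrees with \<open>t\<close> over \<open>b\<close>. This
  carries the restriction through each level of the iteration.\<close>

lemma pos_restrict:
  "pos \<sigma> t X \<Longrightarrow> b \<subseteq> underS r t \<Longrightarrow> small b \<Longrightarrow> pos \<sigma> t {x \<in> X. x \<in> underS r t \<and> agree b x t}"
proof (induction \<sigma> arbitrary: t X)
  case Nil
  show ?case
    unfolding pos.simps reflects_def
  proof (intro allI impI)
    fix b' assume b': "b' \<subseteq> underS r t \<and> small b'"
    then have "b \<union> b' \<subseteq> underS r t" "small (b \<union> b')"
      using Nil(2,3) by (simp_all add: small_Un)
    then obtain u where "u \<in> X" "u \<in> underS r t" "agree (b \<union> b') u t"
      using Nil(1)[unfolded pos.simps] by (metis reflectsE)
    then show "\<exists>u\<in>{x \<in> X. x \<in> underS r t \<and> agree b x t}. u \<in> underS r t \<and> agree b' u t"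
      by (intro bexI[of _ u]) (auto simp: agree_def)
  qed
next
  case (Cons i \<sigma>)
  let ?Y = "{x \<in> X. x \<in> underS r t \<and> agree b x t}"
  show ?case
    unfolding pos.simps reflects_def
  proof (intro allI impI)
    fix b' assume b': "b' \<subseteq> underS r t \<and> small b'"
    then have "b \<union> b' \<subseteq> underS r t" "small (b \<union> b')"
      using Cons.prems(2,3) by (simp_all add: small_Un)
    with Cons.prems(1)[unfolded pos.simps] obtain s
      where "s \<in> {s. pos \<sigma> s (nbhd i s X)}" "s \<in> underS r t" "agree (b \<union> b') s t"
      by (rule reflectsE)
    then have s: "pos \<sigma> s (nbhd i s X)" "s \<in> underS r t" "agree (b \<union> b') s t"
      by simp_all
    then have "pos \<sigma> s {x \<in> nbhd i s X. x \<in> underS r s \<and> agree b x s}"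
      using Cons.prems(3) by (intro Cons.IH) (auto simp: agree_def)
    moreover have "{x \<in> nbhd i s X. x \<in> underS r s \<and> agree b x s} \<subseteq> nbhd i s ?Y"
      using s(2,3) underS_trans by (auto simp: nbhd_def agree_def)
    ultimately have "pos \<sigma> s (nbhd i s ?Y)"
      by (rule pos_mono)
    then show "\<exists>u\<in>{s. pos \<sigma> s (nbhd i s ?Y)}. u \<in> underS r t \<and> agree b' u t"
      using s by (intro bexI[of _ s]) (auto simp: agree_def)
  qed
qed

lemma reflects_below:
  assumes "reflects t X"
  obtains u where "u \<in> X" "u \<in> underS r t"
  by (rule reflectsE[OF assms empty_subsetI small_finite[OF finite.emptyI]]) (rule that)

lemma pos_nonempty: "pos \<sigma> t X \<Longrightarrow> X \<noteq> {}"
proof (induction \<sigma> arbitrary: t X)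
  case Nil
  then show ?case unfolding pos.simps by (elim reflects_below) blast
next
  case (Cons i \<sigma>)
  from Cons.prems[unfolded pos.simps] obtain s where "s \<in> {s. pos \<sigma> s (nbhd i s X)}"
    by (rule reflects_below)
  then have "nbhd i s X \<noteq> {}" by (simp add: Cons.IH)
  then show ?case by (auto simp: nbhd_def)
qed

text \<open>The parameters refuting positivity at \<open>t\<close> also refute it at every lower
  node that agrees with \<open>t\<close> over them.\<close>

lemma not_pos_agree:
  assumes "\<not> pos \<sigma> t X"
  obtains b where "b \<subseteq> underS r t" "small b"
    "\<And>u. u \<in> underS r t \<Longrightarrow> agree b u t \<Longrightarrow> \<not> pos \<sigma> u X"
proof -
  \<comment> \<open>Both cases of \<open>pos\<close> are reflection of a set that does not depend on
    the node, so they can be treated together.\<close>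
  define Y where "Y = (case \<sigma> of [] \<Rightarrow> X | i # \<sigma>' \<Rightarrow> {s. pos \<sigma>' s (nbhd i s X)})"
  have Y: "pos \<sigma> u X \<longleftrightarrow> reflects u Y" for u
    by (cases \<sigma>) (simp_all add: Y_def)
  have "\<not> reflects t Y"
    using assms Y by simp
  then obtain b where b: "b \<subseteq> underS r t" "small b"
    "\<And>u. u \<in> Y \<Longrightarrow> u \<in> underS r t \<Longrightarrow> \<not> agree b u t"
    unfolding reflects_def by blast
  have "\<not> reflects u Y" if u: "u \<in> underS r t" "agree b u t" for u
  proof
    assume "reflects u Y"
    moreover have "b \<subseteq> underS r u" using u(2) by (simp add: agree_def)
    ultimately obtain v where "v \<in> Y" "v \<in> underS r u" "agree b v u"
      using b(2) by (rule reflectsE)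
    moreover from this have "v \<in> underS r t" "agree b v t"
      using u underS_trans by (auto simp: agree_def)
    ultimately show False using b(3) by blast
  qed
  then show ?thesis
    using Y by (intro that[OF b(1,2)]) simp
qed

text \<open>The colour pattern over \<open>f t\<close> is a subset of
  \<open>f t \<times> {..<k}\<close>, so it has few enough values to be made constant along with
  \<open>f\<close>.\<close>

lemma stationary_agree:
  assumes "\<not> nonstationary S"
    and f: "\<And>t. t \<in> S \<Longrightarrow> f t \<subseteq> underS r t" "\<And>t. t \<in> S \<Longrightarrow> small (f t)"
  obtains S' where "S' \<subseteq> S" "\<not> nonstationary S'" "\<And>t u. t \<in> S' \<Longrightarrow> u \<in> S' \<Longrightarrow> agree (f t) u t"
proof -
  define q where "q t = (\<lambda>y. (y, c y t)) ` f t" for t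
  have q: "q t \<in> Pow (f t \<times> {..<k})" if "t \<in> S" for t
    using f(1)[OF that] colour_less by (auto simp: q_def)
  have Q: "|Pow (b \<times> {..<k})| \<le>o |bounded_sets|" if "small b" for b :: "'a set"
    by (rule card_Pow_small[OF small_Times[OF that small_finite]]) simp
  obtain b z where bz: "\<not> nonstationary {t \<in> S. f t = b \<and> q t = z}"
    by (rule stationary_press[where f = f and q = q and Q = "\<lambda>b. Pow (b \<times> {..<k})",
        OF assms(1) f q Q])
  have "agree (f t) u t" if t: "t \<in> {t \<in> S. f t = b \<and> q t = z}" and u: "u \<in> {t \<in> S. f t = b \<and> q t = z}" for t u
  proof -
    have "(y, c y u) \<in> q t" if "y \<in> f t" for y
      using t u that by (force simp: q_def)
    then have "c y u = c y t" if "y \<in> f t" for y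
      using that by (auto simp: q_def)
    with t u f(1)[of u] show ?thesis
      by (auto simp: agree_def)
  qed
  then show ?thesis
    using that[OF _ bz] by blast
qed

text \<open>Otherwise, making the refuting parameters and their colours constant leaves comparable
  nodes \<open>u\<close> and \<open>t\<close> of \<open>S\<close> with \<open>u\<close> agreeing
  with \<open>t\<close>, a contradiction.\<close>

lemma nonstationary_not_reflects:
  "nonstationary {t \<in> S. \<not> reflects t S}"
proof (rule ccontr)
  let ?S = "{t \<in> S. \<not> reflects t S}"
  assume stat: "\<not> nonstationary ?S"
  have "\<forall>t\<in>?S. \<exists>b. b \<subseteq> underS r t \<and> small b \<and> (\<forall>u\<in>S. u \<in> underS r t \<longrightarrow> \<not> agree b u t)"
    unfolding reflects_def by simp
  from bchoice[OF this] obtain b where b: "\<And>t. t \<in> ?S \<Longrightarrow> b t \<subseteq> underS r t" "\<And>t. t \<in> ?S \<Longrightarrow> small (b t)"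
    "\<And>t u. t \<in> ?S \<Longrightarrow> u \<in> S \<Longrightarrow> u \<in> underS r t \<Longrightarrow> \<not> agree (b t) u t"
    by blast
  obtain S' where S': "S' \<subseteq> ?S" "\<not> nonstationary S'" "\<And>t u. t \<in> S' \<Longrightarrow> u \<in> S' \<Longrightarrow> agree (b t) u t"
    using stationary_agree[OF stat b(1,2)] by blast
  then obtain t u where "t \<in> S'" "u \<in> S'" "u \<in> underS r t"
    using nonstationary_antichain by blast
  with S' b(3)[of t u] show False by blast
qed

lemma stationary_reflects:
  assumes "\<not> nonstationary S"
  shows "\<not> nonstationary {t \<in> S. reflects t S}"
proof
  assume "nonstationary {t \<in> S. reflects t S}"
  then have "nonstationary ({t \<in> S. reflects t S} \<union> {t \<in> S. \<not> reflects t S})"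
    using nonstationary_not_reflects by (rule nonstationary_Un)
  moreover have "{t \<in> S. reflects t S} \<union> {t \<in> S. \<not> reflects t S} = S" by blast
  ultimately show False using assms by simp
qed

text \<open>Transfinite recursion: each piece is chosen among nodes of \<open>X\<close> agreeing
  with \<open>s\<close> over the union of the earlier pieces. The earlier nodes have colour
  \<open>i\<close> towards \<open>s\<close>, hence towards the new piece.\<close>

lemma end_homogeneous_family:
  assumes pos: "pos \<sigma> s X" and X: "\<And>x. x \<in> X \<Longrightarrow> x \<in> underS r s \<and> c x s = i"
    and step: "\<And>X'. X' \<subseteq> X \<Longrightarrow> pos \<sigma> s X' \<Longrightarrow> \<exists>W\<subseteq>X'. small W \<and> G W"
    and wo: "Well_order \<rho>" and small: "\<And>a. a \<in> Field \<rho> \<Longrightarrow> small (underS \<rho> a)"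
  shows "\<exists>F. \<forall>a\<in>Field \<rho>. F a \<subseteq> X \<and> G (F a) \<and>
    (\<forall>b\<in>underS \<rho> a. \<forall>y\<in>F b. \<forall>x\<in>F a. y \<in> underS r x \<and> c y x = i)"
proof -
  have wf: "wf (\<rho> - Id)"
    using wo by (simp add: well_order_on_def)
  define ok where "ok P W \<longleftrightarrow> W \<subseteq> {x \<in> X. P \<subseteq> underS r x \<and> (\<forall>y\<in>P. c y x = i)} \<and> small W \<and> G W" for P W
  define F where "F = wfrec (\<rho> - Id) (\<lambda>h a. SOME W. ok (\<Union>(h ` underS \<rho> a)) W)"
  have F: "F a = (SOME W. ok (\<Union>(F ` underS \<rho> a)) W)" for a
  proof -
    have "cut F (\<rho> - Id) a ` underS \<rho> a = F ` underS \<rho> a"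
      by (intro image_cong) (auto simp: cut_apply underS_def)
    then show ?thesis
      unfolding F_def by (subst wfrec[OF wf]) simp
  qed
  have ok: "a \<in> Field \<rho> \<longrightarrow> ok (\<Union>(F ` underS \<rho> a)) (F a)" for a
  proof (induction a rule: wf_induct_rule[OF wf])
    case (1 a)
    show ?case
    proof
      assume a: "a \<in> Field \<rho>"
      let ?P = "\<Union>(F ` underS \<rho> a)"
      have ok: "ok (\<Union>(F ` underS \<rho> b)) (F b)" if "b \<in> underS \<rho> a" for b
        using that 1 by (auto simp: underS_def Field_def)
      then have P: "?P \<subseteq> X" "small ?P"
        using small[OF a] by (auto simp: ok_def intro!: small_UN)
      then have "pos \<sigma> s {x \<in> X. x \<in> underS r s \<and> agree ?P x s}"
        using pos X by (intro pos_restrict) auto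
      then obtain W where "W \<subseteq> {x \<in> X. x \<in> underS r s \<and> agree ?P x s}" "small W" "G W"
        using step[of "{x \<in> X. x \<in> underS r s \<and> agree ?P x s}"] by blast
      then have "ok ?P W"
        using X P(1) by (auto simp: ok_def agree_def subset_eq)
      then show "ok ?P (F a)"
        unfolding F[of a] by (rule someI)
    qed
  qed
  have "F a \<subseteq> X \<and> G (F a) \<and> (\<forall>b\<in>underS \<rho> a. \<forall>y\<in>F b. \<forall>x\<in>F a. y \<in> underS r x \<and> c y x = i)"
    if "a \<in> Field \<rho>" for a
    using ok[of a] that unfolding ok_def by blast
  then show ?thesis by blast
qed

definition homogeneous :: "'i rel \<Rightarrow> nat \<Rightarrow> ('i \<Rightarrow> 'a) \<Rightarrow> 'a set \<Rightarrow> bool" where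
  "homogeneous \<rho> j z X \<longleftrightarrow>
     (\<forall>a\<in>Field \<rho>. z a \<in> X \<and> (\<forall>b\<in>underS \<rho> a. z b \<in> underS r (z a) \<and> c (z b) (z a) = j))"

lemma pos_imp_reflects:
  assumes "pos \<sigma> s X" "\<And>x. x \<in> X \<Longrightarrow> x \<in> underS r s"
  shows "reflects s X"
  unfolding reflects_def
proof (intro allI impI)
  fix b assume "b \<subseteq> underS r s \<and> small b"
  then have "{x \<in> X. x \<in> underS r s \<and> agree b x s} \<noteq> {}"
    using assms(1) by (intro pos_nonempty[OF pos_restrict]) auto
  then show "\<exists>u\<in>X. u \<in> underS r s \<and> agree b u s" by blast
qed

text \<open>For the head colour, single nodes are stacked inside \<open>nbhd i s X\<close>; a later
  colour is found in the same set by induction.\<close>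

lemma homogeneous_below:
  assumes "pos \<sigma> t X" "j \<in> set \<sigma>"
  shows "\<exists>z. homogeneous \<kappa> j z X"
  using assms
proof (induction \<sigma> arbitrary: t X)
  case (Cons i \<sigma>)
  then have "reflects t {s. pos \<sigma> s (nbhd i s X)}" by simp
  then obtain s where "s \<in> {s. pos \<sigma> s (nbhd i s X)}" by (rule reflects_below)
  then have s: "pos \<sigma> s (nbhd i s X)" by simp
  show ?case
  proof (cases "j \<in> set \<sigma>")
    case True
    then obtain z where "homogeneous \<kappa> j z (nbhd i s X)"
      using Cons.IH s by blast
    then have "homogeneous \<kappa> j z X"
      by (auto simp: homogeneous_def nbhd_def)
    then show ?thesis by blast
  next
    case False
    then have [simp]: "j = i" using Cons.prems by simp
    have pos: "pos [] s (nbhd i s X)"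
      using pos_imp_reflects[OF s] by (auto simp: nbhd_def)
    have step: "\<exists>W\<subseteq>X'. small W \<and> W \<noteq> {}" if "pos [] s X'" for X'
    proof -
      have "X' \<noteq> {}" using that by (rule pos_nonempty)
      then obtain x where "x \<in> X'" by blast
      then show ?thesis by (intro exI[of _ "{x}"]) (simp add: small_finite)
    qed
    have nbhd: "x \<in> underS r s \<and> c x s = i" if "x \<in> nbhd i s X" for x
      using that by (simp add: nbhd_def)
    have "Well_order \<kappa>"
      using Card_order by (simp add: card_order_on_def)
    from end_homogeneous_family[where G = "\<lambda>W. W \<noteq> {}", OF pos nbhd step this small_underS]
    obtain F where "\<forall>a\<in>Field \<kappa>. F a \<subseteq> nbhd i s X \<and> F a \<noteq> {} \<and>
      (\<forall>b\<in>underS \<kappa> a. \<forall>y\<in>F b. \<forall>x\<in>F a. y \<in> underS r x \<and> c y x = i)" ..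
    then have F: "\<And>a. a \<in> Field \<kappa> \<Longrightarrow> F a \<subseteq> nbhd i s X" "\<And>a. a \<in> Field \<kappa> \<Longrightarrow> F a \<noteq> {}"
      "\<And>a b y x. a \<in> Field \<kappa> \<Longrightarrow> b \<in> underS \<kappa> a \<Longrightarrow> y \<in> F b \<Longrightarrow> x \<in> F a \<Longrightarrow> y \<in> underS r x \<and> c y x = i"
      by blast+
    define z where "z a = (SOME x. x \<in> F a)" for a
    have z: "z a \<in> F a" if "a \<in> Field \<kappa>" for a
      unfolding z_def using F(2)[OF that] by (simp add: some_in_eq)
    have "homogeneous \<kappa> j z X"
      unfolding homogeneous_def
    proof (intro ballI conjI)
      fix a assume a: "a \<in> Field \<kappa>"
      show "z a \<in> X" using z[OF a] F(1)[OF a] by (auto simp: nbhd_def)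
      fix b assume b: "b \<in> underS \<kappa> a"
      then have "b \<in> Field \<kappa>" by (auto simp: underS_def Field_def)
      with z a b F(3) show "z b \<in> underS r (z a)" "c (z b) (z a) = j" by auto
    qed
    then show ?thesis by blast
  qed
qed simp

text \<open>\<open>W\<close> is made of pieces indexed by \<open>\<xi>\<close>, each suitable for
  the tail, with the head colour between different pieces. The alternative \<open>finite W\<close>
  is there because for finite \<open>\<xi>\<close> the set \<open>W\<close> can outgrow
  \<open>\<xi>\<close>.\<close>

lemma homogeneous_above:
  assumes wo: "Well_order \<xi>" and small: "small (Field \<xi>)" and "pos \<sigma> t X"
  shows "\<exists>W\<subseteq>X. (finite W \<or> |W| \<le>o |Field \<xi>| ) \<and>
    (\<forall>f. f ` W \<subseteq> set \<sigma> \<longrightarrow> (\<exists>j\<in>set \<sigma>. \<exists>y. homogeneous \<xi> j y {w \<in> W. f w = j}))"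
  using assms(3)
proof (induction \<sigma> arbitrary: t X)
  case Nil
  \<comment> \<open>A nonempty \<open>W\<close> makes the claim vacuous, as no \<open>f\<close> maps
    it into the empty set of colours.\<close>
  then obtain x where "x \<in> X" using pos_nonempty by blast
  then show ?case by (intro exI[of _ "{x}"]) simp
next
  case (Cons i \<sigma>)
  then have "reflects t {s. pos \<sigma> s (nbhd i s X)}" by simp
  then obtain s where "s \<in> {s. pos \<sigma> s (nbhd i s X)}" by (rule reflects_below)
  then have s: "pos \<sigma> s (nbhd i s X)" by simp
  define G where "G W \<longleftrightarrow> (finite W \<or> |W| \<le>o |Field \<xi>| ) \<and>
    (\<forall>f. f ` W \<subseteq> set \<sigma> \<longrightarrow> (\<exists>j\<in>set \<sigma>. \<exists>y. homogeneous \<xi> j y {w \<in> W. f w = j}))" for W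
  have small_G: "small W" if "G W" for W
    using that small_finite ordLeq_ordLess_trans[OF _ small] unfolding G_def by metis
  have step: "\<exists>W\<subseteq>X'. small W \<and> G W" if "pos \<sigma> s X'" for X'
  proof -
    have "\<exists>W\<subseteq>X'. G W"
      using Cons.IH[OF that] unfolding G_def .
    then show ?thesis using small_G by metis
  qed
  have small_under: "small (underS \<xi> a)" for a
    by (rule small_subset[OF small]) (auto simp: underS_def Field_def)
  have nbhd: "x \<in> underS r s \<and> c x s = i" if "x \<in> nbhd i s X" for x
    using that by (simp add: nbhd_def)
  from end_homogeneous_family[where G = G, OF s nbhd step wo small_under]
  obtain F where "\<forall>a\<in>Field \<xi>. F a \<subseteq> nbhd i s X \<and> G (F a) \<and>
    (\<forall>b\<in>underS \<xi> a. \<forall>y\<in>F b. \<forall>x\<in>F a. y \<in> underS r x \<and> c y x = i)" ..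
  then have F: "\<And>a. a \<in> Field \<xi> \<Longrightarrow> F a \<subseteq> nbhd i s X" "\<And>a. a \<in> Field \<xi> \<Longrightarrow> G (F a)"
    "\<And>a b y x. a \<in> Field \<xi> \<Longrightarrow> b \<in> underS \<xi> a \<Longrightarrow> y \<in> F b \<Longrightarrow> x \<in> F a \<Longrightarrow> y \<in> underS r x \<and> c y x = i"
    by blast+
  define W where "W = (\<Union>a\<in>Field \<xi>. F a)"
  have "W \<subseteq> X"
    using F(1) unfolding W_def nbhd_def by blast
  moreover have "finite W \<or> |W| \<le>o |Field \<xi>|"
  proof (cases "finite (Field \<xi>)")
    case True
    then have "finite (F a)" if "a \<in> Field \<xi>" for a
      using F(2)[OF that] card_of_ordLeq_finite unfolding G_def by blast
    with True show ?thesis by (simp add: W_def)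
  next
    case False
    have "|F a| \<le>o |Field \<xi>|" if "a \<in> Field \<xi>" for a
    proof (cases "finite (F a)")
      case True
      then show ?thesis
        using finite_ordLess_infinite[OF card_of_Well_order card_of_Well_order, of "F a" "Field \<xi>"] False
        by (simp add: Field_card_of ordLess_imp_ordLeq)
    next
      case False
      then show ?thesis using F(2)[OF that] by (simp add: G_def)
    qed
    then have "|W| \<le>o |Field \<xi>|"
      unfolding W_def using False by (intro card_of_UNION_ordLeq_infinite ballI ordLeq_refl card_of_Card_order)
    then show ?thesis ..
  qed
  moreover have "\<exists>j\<in>set (i # \<sigma>). \<exists>y. homogeneous \<xi> j y {w \<in> W. f w = j}" if f: "f ` W \<subseteq> set (i # \<sigma>)" for f
  \<comment> \<open>Either some piece takes only values from the tail and its own property applies,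
    or every piece contains a node with value \<open>i\<close>, and these nodes form an
    \<open>i\<close>-homogeneous set.\<close>
  proof (cases "\<exists>a\<in>Field \<xi>. f ` F a \<subseteq> set \<sigma>")
    case True
    then obtain a j y where "a \<in> Field \<xi>" "j \<in> set \<sigma>" "homogeneous \<xi> j y {w \<in> F a. f w = j}"
      using F(2) unfolding G_def by meson
    moreover from this have "homogeneous \<xi> j y {w \<in> W. f w = j}"
      by (auto simp: homogeneous_def W_def)
    ultimately show ?thesis by auto
  next
    case False
    have "\<forall>a\<in>Field \<xi>. \<exists>w. w \<in> F a \<and> f w = i"
    proof
      fix a assume a: "a \<in> Field \<xi>"
      then obtain w where "w \<in> F a" "f w \<notin> set \<sigma>"
        using False by blast
      moreover have "f w \<in> set (i # \<sigma>)"
        using f a \<open>w \<in> F a\<close> unfolding W_def by blast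
      ultimately show "\<exists>w. w \<in> F a \<and> f w = i" by auto
    qed
    from bchoice[OF this] obtain y where y: "\<And>a. a \<in> Field \<xi> \<Longrightarrow> y a \<in> F a \<and> f (y a) = i"
      by blast
    have "homogeneous \<xi> i y {w \<in> W. f w = i}"
      unfolding homogeneous_def
    proof (intro ballI conjI)
      fix a assume a: "a \<in> Field \<xi>"
      show "y a \<in> {w \<in> W. f w = i}" using y[OF a] a by (auto simp: W_def)
      fix b assume b: "b \<in> underS \<xi> a"
      then have "b \<in> Field \<xi>" by (auto simp: underS_def Field_def)
      with y a b F(3) show "y b \<in> underS r (y a)" "c (y b) (y a) = i" by auto
    qed
    then show ?thesis by auto
  qed
  ultimately show ?case by (intro exI[of _ W] conjI allI impI) simp_all
qed

end

section \<open>The homogeneous set\<close>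

lemma finite_decreasing_choice:
  assumes "finite J" "P S"
    and mono: "\<And>j S S'. R j S \<Longrightarrow> S' \<subseteq> S \<Longrightarrow> R j S'"
    and step: "\<And>j S'. j \<in> J \<Longrightarrow> S' \<subseteq> S \<Longrightarrow> P S' \<Longrightarrow> \<exists>S''\<subseteq>S'. P S'' \<and> R j S''"
  shows "\<exists>S'\<subseteq>S. P S' \<and> (\<forall>j\<in>J. R j S')"
  using assms(1) step
proof (induction J)
  case empty
  with \<open>P S\<close> show ?case by blast
next
  case (insert j J)
  then obtain S1 where S1: "S1 \<subseteq> S" "P S1" "\<forall>j\<in>J. R j S1" by blast
  with insert.prems[of j S1] obtain S2 where S2: "S2 \<subseteq> S1" "P S2" "R j S2" by blast
  have "\<forall>j\<in>J. R j S2" using S1(3) S2(1) mono by blast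
  with S1(1) S2 show ?case by (intro exI[of _ S2]) auto
qed

context coloured_tree
begin

section \<open>Colour lists that remain positive on stationary sets\<close>

definition positive_points :: "nat list \<Rightarrow> 'a set \<Rightarrow> 'a set" where
  "positive_points \<sigma> S = {t \<in> S. pos \<sigma> t S}"

text \<open>Quantifying over stationary subsets makes the notion survive shrinking, while its
  failure yields a stationary set that is positive almost nowhere on itself.\<close>

definition hereditary :: "nat list \<Rightarrow> 'a set \<Rightarrow> bool" where
  "hereditary \<sigma> S \<longleftrightarrow>
     (\<forall>S'\<subseteq>S. \<not> nonstationary S' \<longrightarrow> \<not> nonstationary (positive_points \<sigma> S'))"

lemma positive_points_mono: "S' \<subseteq> S \<Longrightarrow> positive_points \<sigma> S' \<subseteq> positive_points \<sigma> S"
  using pos_mono by (auto simp: positive_points_def)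

lemma hereditary_Nil: "hereditary [] S"
  using stationary_reflects by (simp add: hereditary_def positive_points_def)

text \<open>A stationary set of such \<open>s\<close> would reflect stationarily many of its own
  elements, and these would be positive for \<open>j # \<sigma>\<close>.\<close>

lemma nonstationary_positive_points_Cons:
  assumes "nonstationary (positive_points (j # \<sigma>) S)"
  shows "nonstationary {s \<in> S. pos \<sigma> s (nbhd j s S)}"
proof (rule ccontr)
  let ?P = "{s \<in> S. pos \<sigma> s (nbhd j s S)}"
  assume "\<not> nonstationary ?P"
  then have "\<not> nonstationary {t \<in> ?P. reflects t ?P}"
    by (rule stationary_reflects)
  moreover have "{t \<in> ?P. reflects t ?P} \<subseteq> positive_points (j # \<sigma>) S"
    unfolding positive_points_def pos.simps using reflects_mono[of _ ?P "{s. pos \<sigma> s (nbhd j s S)}"] by blast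
  ultimately show False using assms nonstationary_subset by blast
qed

lemma stationary_diff:
  assumes "\<not> nonstationary S" "nonstationary N"
  shows "\<not> nonstationary (S - N)"
proof
  assume "nonstationary (S - N)"
  then have "nonstationary ((S - N) \<union> N)" using assms(2) by (rule nonstationary_Un)
  then show False using assms(1) nonstationary_subset by blast
qed

lemma nonstationary_finite_UN:
  assumes "finite I" "\<And>i. i \<in> I \<Longrightarrow> nonstationary (A i)"
  shows "nonstationary (\<Union>i\<in>I. A i)"
  using assms
proof (induction I)
  case empty
  show ?case using nonstationary_antichain[of "{}"] by simp
next
  case (insert i I)
  then show ?case by (simp add: nonstationary_Un)
qed

lemma stationary_above:
  assumes "\<not> nonstationary S"
  obtains t where "t \<in> S" "\<not> nonstationary {s \<in> S. t \<in> underS r s}"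
proof -
  define f where "f s = (if \<exists>t\<in>S. t \<in> underS r s then {SOME t. t \<in> S \<and> t \<in> underS r s} else {})" for s
  have f: "f s = {} \<and> \<not> (\<exists>t\<in>S. t \<in> underS r s) \<or> (\<exists>t\<in>S. f s = {t} \<and> t \<in> underS r s)" for s
    using someI_ex[of "\<lambda>t. t \<in> S \<and> t \<in> underS r s"] by (auto simp: f_def)
  have 1: "f s \<subseteq> underS r s" "small (f s)" for s
    using f[of s] small_finite[of "f s"] by auto
  obtain b where "\<not> nonstationary {s \<in> S. f s = b \<and> () = ()}"
    by (rule stationary_press[where f = f and q = "\<lambda>_. ()" and Q = "\<lambda>_. {()}", OF assms 1 _ card_finite_bounded_sets])
      auto
  then have b: "\<not> nonstationary {s \<in> S. f s = b}" by simp
  \<comment> \<open>Two comparable nodes in the fibre show that the constant value \<open>b\<close>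
    is not the default \<open>{}\<close>.\<close>
  then obtain s u where "s \<in> S" "f s = b" "u \<in> S" "u \<in> underS r s"
    using nonstationary_antichain[of "{s \<in> S. f s = b}"] by blast
  with f[of s] obtain t where t: "t \<in> S" "b = {t}" by blast
  have "{s \<in> S. f s = b} \<subseteq> {s \<in> S. t \<in> underS r s}"
    using 1(1) t(2) by auto
  with b nonstationary_subset that[OF t(1)] show ?thesis by blast
qed

text \<open>A colouring is determined by its graph, a subset of \<open>W \<times> {..<k}\<close>,
  which is finite or no larger than \<open>Field \<xi>\<close>.\<close>

lemma small_colourings:
  assumes "ctwo ^c |Field \<xi>| <o \<kappa>" "finite W \<or> |W| \<le>o |Field \<xi>|"
  shows "small (W \<rightarrow>\<^sub>E {..<k})"
proof -
  have "small (Pow (W \<times> {..<k}))"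
  proof (cases "finite W")
    case True
    then show ?thesis by (simp add: small_finite)
  next
    case False
    have "|W \<times> {..<k}| \<le>o |Field \<xi>|"
    proof -
      have W: "|W| \<le>o |Field \<xi>|" using False assms(2) by blast
      then have inf: "infinite (Field \<xi>)" using False card_of_ordLeq_finite by blast
      have "|{..<k}| \<le>o |Field \<xi>|"
        using finite_ordLess_infinite[OF card_of_Well_order card_of_Well_order, of "{..<k}" "Field \<xi>"] inf
        by (simp add: Field_card_of ordLess_imp_ordLeq)
      with W inf show ?thesis by (intro card_of_Sigma_ordLeq_infinite) auto
    qed
    then obtain h where h: "inj_on h (W \<times> {..<k})" "h ` (W \<times> {..<k}) \<subseteq> Field \<xi>"
      by (auto simp: card_of_ordLeq[symmetric])
    have "small (Pow (Field \<xi>))"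
      using assms(1) card_of_Pow_Func[of "Field \<xi>"] ordIso_ordLess_trans
      by (auto simp: cexp_def ctwo_def Field_card_of)
    moreover have "|Pow (W \<times> {..<k})| \<le>o |Pow (Field \<xi>)|"
      unfolding card_of_ordLeq[symmetric]
      using inj_on_image_Pow[OF h(1)] image_Pow_mono[OF h(2)] by blast
    ultimately show ?thesis using ordLeq_ordLess_trans by blast
  qed
  moreover have "|W \<rightarrow>\<^sub>E {..<k}| \<le>o |Pow (W \<times> {..<k})|"
    unfolding card_of_ordLeq[symmetric]
  proof (intro exI conjI)
    show "inj_on (\<lambda>g. {(w, g w) |w. w \<in> W}) (W \<rightarrow>\<^sub>E {..<k})"
    proof (rule inj_onI)
      fix g h assume gh: "g \<in> W \<rightarrow>\<^sub>E {..<k}" "h \<in> W \<rightarrow>\<^sub>E {..<k}" and eq: "{(w, g w) |w. w \<in> W} = {(w, h w) |w. w \<in> W}"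
      have "g w = h w" if "w \<in> W" for w
      proof -
        have "(w, g w) \<in> {(w, h w) |w. w \<in> W}" using that eq by blast
        then show ?thesis by blast
      qed
      with gh show "g = h" by (intro PiE_ext)
    qed
  qed auto
  ultimately show ?thesis using ordLeq_ordLess_trans by blast
qed

lemma homogeneous_sum:
  assumes stat: "\<not> nonstationary T" and wo: "Well_order \<xi>" and \<xi>: "ctwo ^c |Field \<xi>| <o \<kappa>"
  shows "\<exists>j<k. \<exists>z y. homogeneous \<kappa> j z T \<and> homogeneous \<xi> j y T \<and>
    (\<forall>a\<in>Field \<kappa>. \<forall>b\<in>Field \<xi>. z a \<in> underS r (y b) \<and> c (z a) (y b) = j)"
proof -
  have small_\<xi>: "small (Field \<xi>)"
  proof -
    have "|Field \<xi>| <o |Pow (Field \<xi>)|" by (rule card_of_Pow)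
    also have "|Pow (Field \<xi>)| =o ctwo ^c |Field \<xi>|"
      using card_of_Pow_Func[of "Field \<xi>"] by (simp add: cexp_def ctwo_def Field_card_of)
    finally show ?thesis using \<xi> by (rule ordLess_transitive)
  qed
  define good where "good \<sigma> \<longleftrightarrow> distinct \<sigma> \<and> set \<sigma> \<subseteq> {..<k} \<and>
    (\<exists>S. \<not> nonstationary S \<and> hereditary \<sigma> S)" for \<sigma>
  have "good []"
    using stat hereditary_Nil by (auto simp: good_def)
  moreover have "length \<sigma> < Suc k" if "good \<sigma>" for \<sigma>
    using that distinct_card[of \<sigma>] card_mono[of "{..<k}" "set \<sigma>"] by (simp add: good_def)
  \<comment> \<open>Distinct lists of colours below \<open>k\<close> have bounded length, so a
    longest good one exists.\<close>
  ultimately obtain \<sigma> where "good \<sigma>" and max: "\<And>\<tau>. good \<tau> \<Longrightarrow> length \<tau> \<le> length \<sigma>"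
    using ex_has_greatest_nat[of good "[]" length "Suc k"] by auto
  then obtain S0 where \<sigma>: "distinct \<sigma>" "set \<sigma> \<subseteq> {..<k}" and S0: "\<not> nonstationary S0" "hereditary \<sigma> S0"
    by (auto simp: good_def)
  define J where "J = {..<k} - set \<sigma>"
  have "\<exists>S''\<subseteq>S'. \<not> nonstationary S'' \<and> nonstationary (positive_points (j # \<sigma>) S'')"
    if "j \<in> J" "\<not> nonstationary S'" for j S'
  proof -
    have "\<not> good (j # \<sigma>)" using max[of "j # \<sigma>"] by auto
    with that \<sigma> have "\<not> hereditary (j # \<sigma>) S'" by (auto simp: good_def J_def)
    then show ?thesis by (auto simp: hereditary_def)
  qed
  then obtain S where S: "S \<subseteq> S0" "\<not> nonstationary S"
    and nonpos: "\<And>j. j \<in> J \<Longrightarrow> nonstationary (positive_points (j # \<sigma>) S)"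
    using finite_decreasing_choice[of J "\<lambda>S. \<not> nonstationary S" S0 "\<lambda>j S. nonstationary (positive_points (j # \<sigma>) S)"]
      S0(1) nonstationary_subset[OF _ positive_points_mono] by (auto simp: J_def)
  have hered: "\<not> nonstationary (positive_points \<sigma> S')" if "S' \<subseteq> S" "\<not> nonstationary S'" for S'
    using S0(2) S(1) that unfolding hereditary_def by blast
  \<comment> \<open>Discard the nodes below which a colour outside \<open>\<sigma>\<close> is positive, and press the witnesses: for
    \<open>t\<close> below \<open>s\<close> in the resulting set \<open>Q'\<close>, the colours outside \<open>\<sigma>\<close> towards \<open>s\<close> are null at \<open>t\<close>.\<close>
  define Q where "Q = positive_points \<sigma> S - (\<Union>j\<in>J. {s \<in> S. pos \<sigma> s (nbhd j s S)})"
  have "\<not> nonstationary Q"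
    unfolding Q_def
    by (intro stationary_diff hered S nonstationary_finite_UN nonstationary_positive_points_Cons nonpos)
      (auto simp: J_def)
  have Q: "s \<in> S" "pos \<sigma> s S" "\<And>j. j \<in> J \<Longrightarrow> \<not> pos \<sigma> s (nbhd j s S)" if "s \<in> Q" for s
    using that by (auto simp: Q_def positive_points_def)
  have "\<exists>b. b \<subseteq> underS r s \<and> small b \<and> (\<forall>j\<in>J. \<forall>u. u \<in> underS r s \<longrightarrow> agree b u s \<longrightarrow> \<not> pos \<sigma> u (nbhd j s S))"
    if s: "s \<in> Q" for s
  proof -
    have "\<forall>j\<in>J. \<exists>b. b \<subseteq> underS r s \<and> small b \<and> (\<forall>u. u \<in> underS r s \<longrightarrow> agree b u s \<longrightarrow> \<not> pos \<sigma> u (nbhd j s S))"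
    proof
      fix j assume "j \<in> J"
      from not_pos_agree[OF Q(3)[OF s this]]
      show "\<exists>b. b \<subseteq> underS r s \<and> small b \<and> (\<forall>u. u \<in> underS r s \<longrightarrow> agree b u s \<longrightarrow> \<not> pos \<sigma> u (nbhd j s S))"
        by metis
    qed
    from bchoice[OF this] obtain b where b: "\<And>j. j \<in> J \<Longrightarrow> b j \<subseteq> underS r s" "\<And>j. j \<in> J \<Longrightarrow> small (b j)"
      "\<And>j u. j \<in> J \<Longrightarrow> u \<in> underS r s \<Longrightarrow> agree (b j) u s \<Longrightarrow> \<not> pos \<sigma> u (nbhd j s S)"
      by blast
    show ?thesis
    proof (intro exI conjI ballI allI impI)
      show "(\<Union>j\<in>J. b j) \<subseteq> underS r s" using b(1) by blast
      show "small (\<Union>j\<in>J. b j)"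
        by (rule small_UN[OF small_finite b(2)]) (auto simp: J_def)
      fix j u assume "j \<in> J" "u \<in> underS r s" "agree (\<Union>j\<in>J. b j) u s"
      moreover from this have "agree (b j) u s" by (auto simp: agree_def)
      ultimately show "\<not> pos \<sigma> u (nbhd j s S)" using b(3) by blast
    qed
  qed
  then have "\<forall>s\<in>Q. \<exists>b. b \<subseteq> underS r s \<and> small b \<and> (\<forall>j\<in>J. \<forall>u. u \<in> underS r s \<longrightarrow> agree b u s \<longrightarrow> \<not> pos \<sigma> u (nbhd j s S))"
    by blast
  from bchoice[OF this] obtain b where b: "\<And>s. s \<in> Q \<Longrightarrow> b s \<subseteq> underS r s" "\<And>s. s \<in> Q \<Longrightarrow> small (b s)"
    "\<And>s j u. s \<in> Q \<Longrightarrow> j \<in> J \<Longrightarrow> u \<in> underS r s \<Longrightarrow> agree (b s) u s \<Longrightarrow> \<not> pos \<sigma> u (nbhd j s S)"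
    by blast
  obtain Q' where Q': "Q' \<subseteq> Q" "\<not> nonstationary Q'" "\<And>t u. t \<in> Q' \<Longrightarrow> u \<in> Q' \<Longrightarrow> agree (b t) u t"
    using stationary_agree[where f = b, OF \<open>\<not> nonstationary Q\<close> b(1,2)] by metis
  obtain t where t: "t \<in> Q'" and above: "\<not> nonstationary {s \<in> Q'. t \<in> underS r s}"
    using stationary_above[OF Q'(2)] .
  let ?V = "{s \<in> Q'. t \<in> underS r s}"
  have "?V \<subseteq> S" using Q'(1) Q(1) by blast
  then have "\<not> nonstationary (positive_points \<sigma> ?V)" using above by (rule hered)
  \<comment> \<open>Positivity of \<open>?V\<close> at a single node is enough to extract
    \<open>W\<close> from it.\<close>
  then obtain v where "pos \<sigma> v ?V"
    using nonstationary_antichain[of "positive_points \<sigma> ?V"] unfolding positive_points_def by blast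
  from homogeneous_above[OF wo small_\<xi> this]
  obtain W where W: "W \<subseteq> ?V" "finite W \<or> |W| \<le>o |Field \<xi>|"
    and W_hom: "\<And>f. f ` W \<subseteq> set \<sigma> \<Longrightarrow> \<exists>j\<in>set \<sigma>. \<exists>y. homogeneous \<xi> j y {w \<in> W. f w = j}"
    by blast
  \<comment> \<open>Nodes below \<open>t\<close> are sorted by their colours towards
    \<open>W\<close>. There are fewer than \<open>\<kappa>\<close> patterns, so one class is
    positive at \<open>t\<close>.\<close>
  define X where "X g = {x \<in> S. x \<in> underS r t \<and> (\<forall>w\<in>W. c x w = g w)}" for g
  have "pos \<sigma> t S" using t Q'(1) Q(2) by blast
  then have "pos \<sigma> t {x \<in> S. x \<in> underS r t \<and> agree {} x t}"
    by (rule pos_restrict) (simp_all add: small_finite)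
  moreover have "{x \<in> S. x \<in> underS r t \<and> agree {} x t} \<subseteq> (\<Union>g\<in>W \<rightarrow>\<^sub>E {..<k}. X g)"
  proof
    fix x assume x: "x \<in> {x \<in> S. x \<in> underS r t \<and> agree {} x t}"
    have "c x w < k" if "w \<in> W" for w
      using that W(1) x underS_trans by (intro colour_less) blast
    then have "(\<lambda>w\<in>W. c x w) \<in> W \<rightarrow>\<^sub>E {..<k}" by auto
    moreover have "x \<in> X (\<lambda>w\<in>W. c x w)" using x by (simp add: X_def)
    ultimately show "x \<in> (\<Union>g\<in>W \<rightarrow>\<^sub>E {..<k}. X g)" by blast
  qed
  ultimately have "pos \<sigma> t (\<Union>g\<in>W \<rightarrow>\<^sub>E {..<k}. X g)" by (rule pos_mono)
  from pos_UN[OF small_colourings[OF \<xi> W(2)] this]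
  obtain g where g: "g \<in> W \<rightarrow>\<^sub>E {..<k}" "pos \<sigma> t (X g)" by blast
  \<comment> \<open>Otherwise a colour outside \<open>\<sigma>\<close> towards \<open>w\<close>
    would be positive at \<open>t\<close>, which the agreement of \<open>t\<close> with
    \<open>w\<close> over \<open>b w\<close> excludes.\<close>
  have "g w \<in> set \<sigma>" if "w \<in> W" for w
  proof (rule ccontr)
    assume "g w \<notin> set \<sigma>"
    then have J: "g w \<in> J" using g(1) that by (auto simp: J_def)
    have w: "w \<in> Q'" "t \<in> underS r w" using that W(1) by auto
    have "X g \<subseteq> nbhd (g w) w S"
      using that w(2) underS_trans by (auto simp: X_def nbhd_def)
    with g(2) have "pos \<sigma> t (nbhd (g w) w S)" by (rule pos_mono)
    moreover have "agree (b w) t w" using Q'(3) w(1) t by blast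
    ultimately show False
      using b(3)[of w "g w" t] Q'(1) w J by blast
  qed
  \<comment> \<open>The pattern \<open>g\<close> is itself a colouring of \<open>W\<close> by
    \<open>\<sigma>\<close>. Its value \<open>j\<close> on the upper block is then the colour
    between the blocks, and the lower block is chosen homogeneous for the same
    \<open>j\<close>.\<close>
  then obtain j y where j: "j \<in> set \<sigma>" and y: "homogeneous \<xi> j y {w \<in> W. g w = j}"
    using W_hom[of g] by blast
  obtain z where z: "homogeneous \<kappa> j z (X g)"
    using homogeneous_below[OF g(2) j] by blast
  show ?thesis
  proof (intro exI[of _ j] exI[of _ z] exI[of _ y] conjI[of "_ < _"] conjI[of "homogeneous _ _ _ _"] ballI)
    show "j < k" using j \<sigma>(2) by auto
    have "X g \<subseteq> T" using underS_in_tree by (auto simp: X_def)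
    with z show "homogeneous \<kappa> j z T" unfolding homogeneous_def by blast
    have "W \<subseteq> T" using W(1) underS_in_tree by blast
    with y show "homogeneous \<xi> j y T" unfolding homogeneous_def by blast
    fix a b assume "a \<in> Field \<kappa>" "b \<in> Field \<xi>"
    with y z have "z a \<in> X g" "y b \<in> W" "g (y b) = j"
      by (auto simp: homogeneous_def)
    with W(1) show "z a \<in> underS r (y b) \<and> c (z a) (y b) = j"
      using underS_trans by (auto simp: X_def)
  qed
qed

end

theorem mainTheorem1:
  fixes \<kappa> :: "'k rel" and \<xi> :: "'x rel" and k :: nat
    and T :: "'a set" and r :: "'a rel"
  assumes "Card_order \<kappa>" and "cinfinite \<kappa>" and "regularCard \<kappa>"
    and "Well_order \<xi>" and "ctwo ^c |Field \<xi>| <o \<kappa>"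
    and "tree_on T r" and "\<not> special_tree (weak_cexp ctwo \<kappa>) T r"
  shows "tree_arrow T r (ord_sum \<kappa> \<xi>) k"
  unfolding tree_arrow_def
proof
  fix c assume c: "c \<in> chain_pairs T r \<rightarrow> {..<k}"
  have po: "partial_order_on T r"
    using assms(6) by (simp add: tree_on_def)
  then have r: "r \<subseteq> T \<times> T" "\<And>x. x \<in> T \<Longrightarrow> (x, x) \<in> r"
    by (auto simp: partial_order_on_def preorder_on_def refl_on_def)
  interpret coloured_tree \<kappa> T r "\<lambda>u t. c {u, t}" k
  proof
    fix u t assume "u \<in> underS r t"
    then have "u \<noteq> t" "(u, t) \<in> r" "u \<in> T" "t \<in> T"
      using r(1) by (auto simp: underS_def)
    \<comment> \<open>\<open>Chains\<close> also compares each node with itself, hence the appeal to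
      reflexivity.\<close>
    then have "{u, t} \<in> chain_pairs T r"
      using r(2) by (auto simp: chain_pairs_def nsets_def Chains_def)
    then show "c {u, t} < k" using c by blast
  qed (fact assms)+
  have "\<not> nonstationary T"
    using special_if_nonstationary assms(7) by blast
  then obtain j z y where j: "j < k" and z: "homogeneous \<kappa> j z T" and y: "homogeneous \<xi> j y T"
    and zy: "\<forall>a\<in>Field \<kappa>. \<forall>b\<in>Field \<xi>. z a \<in> underS r (y b) \<and> c {z a, y b} = j"
    using homogeneous_sum[OF _ assms(4,5)] by blast
  define \<rho> where "\<rho> = ord_sum \<kappa> \<xi>"
  define \<phi> where "\<phi> = case_sum z y"
  define X where "X = \<phi> ` Field \<rho>"
  have wo: "Well_order \<rho>"
    unfolding \<rho>_def using assms(1,4) by (intro Well_order_ord_sum) (simp_all add: card_order_on_def)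
  have inc: "\<phi> a \<in> underS r (\<phi> b) \<and> c {\<phi> a, \<phi> b} = j" if "(a, b) \<in> \<rho>" "a \<noteq> b" for a b
  proof -
    consider a' b' where "a = Inl a'" "b = Inl b'" "(a', b') \<in> \<kappa>" "a' \<noteq> b'"
      | a' b' where "a = Inr a'" "b = Inr b'" "(a', b') \<in> \<xi>" "a' \<noteq> b'"
      | a' b' where "a = Inl a'" "b = Inr b'" "a' \<in> Field \<kappa>" "b' \<in> Field \<xi>"
      using \<open>(a, b) \<in> \<rho>\<close> \<open>a \<noteq> b\<close> unfolding \<rho>_def ord_sum_def by blast
    then show ?thesis
    proof cases
      case 1
      then have "b' \<in> Field \<kappa>" "a' \<in> underS \<kappa> b'" by (auto simp: underS_def intro: FieldI2)
      with z 1 show ?thesis by (simp add: homogeneous_def \<phi>_def)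
    next
      case 2
      then have "b' \<in> Field \<xi>" "a' \<in> underS \<xi> b'" by (auto simp: underS_def intro: FieldI2)
      with y 2 show ?thesis by (simp add: homogeneous_def \<phi>_def)
    next
      case 3
      with zy show ?thesis by (simp add: \<phi>_def)
    qed
  qed
  have "X \<subseteq> T"
    using z y by (auto simp: X_def \<phi>_def \<rho>_def Field_ord_sum homogeneous_def)
  moreover have "Restr r X =o \<rho>" "X \<in> Chains r"
    using strictly_increasing_image[of T r \<rho> \<phi>] po wo \<open>X \<subseteq> T\<close> inc unfolding X_def by blast+
  moreover have "c {s, t} = j" if st: "s \<in> X" "t \<in> X" "s \<noteq> t" for s t
  proof -
    obtain a b where ab: "a \<in> Field \<rho>" "b \<in> Field \<rho>" "s = \<phi> a" "t = \<phi> b"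
      using st by (auto simp: X_def)
    then have "a \<noteq> b" using st by blast
    with ab wo have "(a, b) \<in> \<rho> \<or> (b, a) \<in> \<rho>"
      by (auto simp: well_order_on_def linear_order_on_def total_on_def)
    then show ?thesis
      using inc \<open>a \<noteq> b\<close> ab by (metis insert_commute)
  qed
  ultimately show "\<exists>X \<chi>. X \<subseteq> T \<and> X \<in> Chains r \<and> Restr r X =o ord_sum \<kappa> \<xi> \<and> \<chi> < k \<and>
      (\<forall>s\<in>X. \<forall>t\<in>X. s \<noteq> t \<longrightarrow> c {s, t} = \<chi>)"
    using j unfolding \<rho>_def by blast
qed

end
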